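(* There is a function $G(d)>0$ such that the following holds. Let $C\subset\mathbb{R}^d$ be a convex body and $\mu$ a non-$C$-degenerate measure on $\mathbb{R}^d$ with $\mu(C)>0$ and $\mu(\mathbb{R}^d)>\mu(C)$. Then $\delta_H(\mu,C)\ge G(d)$.
   Context: A convex body is a convex compact set with nonempty interior; a homothet of $C$ is $\lambda C+x$ with $\lambda>0$, $x\in\mathbb{R}^d$. Measures are Borel measures on $\mathbb{R}^d$ finite on compact sets; $\mu$ is non-$C$-degenerate if it vanishes on the boundary of every homothet of $C$. Let $B^d$ be the open unit Euclidean ball centered at the origin. For a family $\mathcal{A}$ of sets of finite measure and a set $D$ of finite positive measure, $d_{\mathrm{out}}(\mu,\mathcal{A}|D)=\frac{1}{\mu(D)}\sum_{A\in\mathcal{A},A\cap D\neq\emptyset}\mu(A)$, and $d_{\mathrm{upp}}(\mu,\mathcal{A})=\limsup_{r\to\infty}d_{\mathrm{out}}(\mu,\mathcal{A}|rB^d)$. The homothety packing density with respect to $\mu$ is $\delta_H(\mu,C)=\sup\{d_{\mathrm{upp}}(\mu,\mathcal{P})\}$, where the supremum is over all packings $\mathcal{P}$ (families of sets with pairwise disjoint interiors) of homothets of $C$ each of $\mu$-measure exactly $\mu(C)$. *)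

theory Defs
  imports "HOL-Analysis.Analysis"
begin

definition convex_body :: "'a::euclidean_space set \<Rightarrow> bool" where
  "convex_body C \<longleftrightarrow> convex C \<and> compact C \<and> interior C \<noteq> {}"

definition homothets :: "'a::euclidean_space set \<Rightarrow> 'a set set" where
  "homothets C = {(\<lambda>y. l *\<^sub>R y + x) ` C | l x. l > 0}"

definition loc_finite_borel :: "'a::euclidean_space measure \<Rightarrow> bool" where
  "loc_finite_borel M \<longleftrightarrow> sets M = sets borel \<and>
     (\<forall>K. compact K \<longrightarrow> emeasure M K < \<infinity>)"

definition non_C_degenerate :: "'a::euclidean_space measure \<Rightarrow> 'a set \<Rightarrow> bool" where
  "non_C_degenerate M C \<longleftrightarrow> (\<forall>H\<in>homothets C. emeasure M (frontier H) = 0)"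

definition d_out :: "'a::euclidean_space measure \<Rightarrow> 'a set set \<Rightarrow> 'a set \<Rightarrow> ennreal" where
  "d_out M \<A> D =
     (SUP F\<in>{F. finite F \<and> F \<subseteq> {A\<in>\<A>. A \<inter> D \<noteq> {}}}. \<Sum>A\<in>F. emeasure M A) / emeasure M D"

definition d_upp :: "'a::euclidean_space measure \<Rightarrow> 'a set set \<Rightarrow> ennreal" where
  "d_upp M \<A> = Limsup at_top (\<lambda>r::real. d_out M \<A> (ball 0 r))"

definition packing :: "'a::euclidean_space set set \<Rightarrow> bool" where
  "packing P \<longleftrightarrow> (\<forall>A\<in>P. \<forall>B\<in>P. A \<noteq> B \<longrightarrow> interior A \<inter> interior B = {})"

definition delta_H :: "'a::euclidean_space measure \<Rightarrow> 'a set \<Rightarrow> ennreal" where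
  "delta_H M C = (SUP P\<in>{P. packing P \<and> P \<subseteq> homothets C \<and>
                          (\<forall>A\<in>P. emeasure M A = emeasure M C)}. d_upp M P)"

end

theory Submission
  imports Defs
begin

text \<open>
  Choose the centre of \<open>C\<close> so that the asymmetry of \<open>C\<close> about it is at most the dimension, and let \<open>p\<close>
  be the gauge of the centred body. Since homothets have null boundary, every point \<open>x\<close> is the centre
  of a homothet \<open>body x\<close> of measure exactly that of \<open>C\<close>. Consider those bodies that meet a given body
  of comparable or smaller size. In a narrow cone seen from the small body, the body of an almost
  farthest centre contains all other centres in that cone, so boundedly many (in terms of the
  dimension) of these bodies cover all of the centres. Hence, selecting disjoint bodies centred in a ball
  greedily with the smallest first, the selected bodies carry a fixed fraction of the measure of the
  ball. If the total measure is finite, one large ball suffices. Otherwise this is iterated: by the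
  same covering argument, only a set of bounded measure of centres is lost by demanding that the new
  bodies avoid the finitely many old ones, and this loss is negligible in a sufficiently large ball.
\<close>

section \<open>A centre of bounded asymmetry, by Helly's theorem\<close>

text \<open>If \<open>c\<close> lies in every \<open>f x\<close> below, then
  \<open>c = (x + n y) / (n + 1)\<close> with \<open>y\<close> in \<open>C\<close>, and this
  \<open>y\<close> is the required reflected and shrunk copy of \<open>x\<close>. The factor depends
  on the dimension only, which is what frees the final constant from \<open>C\<close>.\<close>

lemma exists_center_bounded_asymmetry:
  fixes C :: "'a::euclidean_space set"
  assumes "convex C" "compact C" "C \<noteq> {}"
  obtains c where "c \<in> C" "\<And>x. x \<in> C \<Longrightarrow> c - (1 / real DIM('a)) *\<^sub>R (x - c) \<in> C"
proof -
  let ?n = "real DIM('a)"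
  have n: "?n \<ge> 1" by (simp add: DIM_ge_Suc0 Suc_leI)
  \<comment> \<open>Any \<open>n + 1\<close> of the sets \<open>f x\<close> share the barycentre of their parameters, so Helly's theorem applies.\<close>
  define f where "f x = (\<lambda>y. (1 / (?n + 1)) *\<^sub>R x + (?n / (?n + 1)) *\<^sub>R y) ` C" for x
  have f_eq: "f x = (+) ((1 / (?n + 1)) *\<^sub>R x) ` ((*\<^sub>R) (?n / (?n + 1)) ` C)" for x
    unfolding f_def by (simp add: image_image)
  have conv: "convex (f x)" and comp: "compact (f x)" for x
    unfolding f_eq using assms by (simp_all add: convex_translation convex_scaling compact_translation compact_scaling)
  have few: "C \<inter> (\<Inter>x\<in>J. f x) \<noteq> {}" if J: "finite J" "J \<subseteq> C" "card J \<le> DIM('a) + 1" for J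
  proof -
    obtain x0 where x0: "x0 \<in> C" using assms by blast
    \<comment> \<open>The common point \<open>z\<close> is the mean of the points of
      \<open>J\<close>, padded by \<open>k\<close> copies of \<open>x0\<close> to total weight
      \<open>n + 1\<close>. Splitting off one \<open>x\<close> in \<open>J\<close> leaves total
      weight \<open>n\<close>, whose mean is again in \<open>C\<close>; hence \<open>z\<close> is in
      \<open>f x\<close>.\<close>
    define k where "k = ?n + 1 - real (card J)"
    have k: "k \<ge> 0" using J by (simp add: k_def)
    define z where "z = (1 / (?n + 1)) *\<^sub>R (k *\<^sub>R x0 + \<Sum>J)"
    have avg: "(1 / w) *\<^sub>R (l *\<^sub>R x0 + \<Sum>I) \<in> C"
      if "finite I" "I \<subseteq> C" "l \<ge> 0" "w = l + real (card I)" "w > 0" for I l w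
    proof (cases "I = {}")
      case True
      then show ?thesis using that x0 by simp
    next
      case False
      have "(\<Sum>i\<in>I. (1 / real (card I)) *\<^sub>R i) \<in> C"
        using that assms False by (intro convex_sum) auto
      then have "(l / w) *\<^sub>R x0 + (real (card I) / w) *\<^sub>R (\<Sum>i\<in>I. (1 / real (card I)) *\<^sub>R i) \<in> C"
        using x0 that by (intro convexD[OF assms(1)]) (auto simp: add_divide_distrib[symmetric])
      also have "(l / w) *\<^sub>R x0 + (real (card I) / w) *\<^sub>R (\<Sum>i\<in>I. (1 / real (card I)) *\<^sub>R i)
        = (1 / w) *\<^sub>R (l *\<^sub>R x0 + \<Sum>I)"
        using False that by (simp add: scaleR_sum_right[symmetric] algebra_simps)
      finally show ?thesis .
    qed
    have "z \<in> C"
      unfolding z_def using J k n by (intro avg) (auto simp: k_def)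
    moreover have "z \<in> f x" if "x \<in> J" for x
    proof -
      have "card J = Suc (card (J - {x}))" using card.remove[OF J(1) that] by simp
      then have "(1 / ?n) *\<^sub>R (k *\<^sub>R x0 + \<Sum>(J - {x})) \<in> C"
        using J k n by (intro avg) (auto simp: k_def)
      moreover have "\<Sum>J = x + \<Sum>(J - {x})"
        using J that by (simp add: sum.remove)
      then have "z = (1 / (?n + 1)) *\<^sub>R x + (?n / (?n + 1)) *\<^sub>R ((1 / ?n) *\<^sub>R (k *\<^sub>R x0 + \<Sum>(J - {x})))"
        using n by (simp add: z_def algebra_simps)
      ultimately show ?thesis unfolding f_def by blast
    qed
    ultimately show ?thesis by blast
  qed
  have "C \<inter> (\<Inter>x\<in>C. f x) \<noteq> {}"
  proof (rule compact_imp_fip_image[OF assms(2)])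
    show "closed (f x)" for x using comp compact_imp_closed by blast
    fix J assume J: "finite J" "J \<subseteq> C"
    show "C \<inter> (\<Inter>x\<in>J. f x) \<noteq> {}"
    \<comment> \<open>Helly's theorem speaks of at least \<open>DIM('a) + 1\<close> sets; smaller
      collections are settled by \<open>few\<close> directly.\<close>
    proof (cases "card (insert C (f ` J)) \<ge> DIM('a) + 1")
      case True
      have "\<Inter>(insert C (f ` J)) \<noteq> {}"
      proof (rule Helly[OF True])
        show "\<forall>s\<in>insert C (f ` J). convex s" using assms conv by auto
        fix t assume t: "t \<subseteq> insert C (f ` J)" "card t = DIM('a) + 1"
        have "finite t" using t J finite_subset by (metis card.infinite add_is_0 one_neq_zero)
        have "t - {C} \<subseteq> f ` J" using t by blast
        then obtain J' where J': "J' \<subseteq> J" "inj_on f J'" "t - {C} = f ` J'"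
          by (meson subset_image_inj)
        have "card J' \<le> DIM('a) + 1"
          using J' t \<open>finite t\<close> by (metis card_Diff1_le card_image)
        then have "C \<inter> (\<Inter>x\<in>J'. f x) \<noteq> {}"
          using few[of J'] J J' finite_subset by (metis subset_trans)
        moreover have "C \<inter> (\<Inter>x\<in>J'. f x) \<subseteq> \<Inter>t"
          using J'(3) by blast
        ultimately show "\<Inter>t \<noteq> {}" by blast
      qed
      then show ?thesis by simp
    next
      case False
      obtain J' where J': "J' \<subseteq> J" "inj_on f J'" "f ` J = f ` J'"
        by (meson subset_image_inj order_refl)
      have "card (f ` J) \<le> card (insert C (f ` J))" using J by (intro card_mono) auto
      then have "card J' \<le> DIM('a) + 1" using False J' by (simp add: card_image)
      then have "C \<inter> (\<Inter>x\<in>J'. f x) \<noteq> {}"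
        using few[of J'] J J' finite_subset by (metis subset_trans)
      then show ?thesis using J' by simp
    qed
  qed
  then obtain c where c: "c \<in> C" "\<And>x. x \<in> C \<Longrightarrow> c \<in> f x" by blast
  have "c - (1 / ?n) *\<^sub>R (x - c) \<in> C" if x: "x \<in> C" for x
  proof -
    obtain y where y: "y \<in> C" "c = (1 / (?n + 1)) *\<^sub>R x + (?n / (?n + 1)) *\<^sub>R y"
      using c(2)[OF x] unfolding f_def by blast
    then have "(?n + 1) *\<^sub>R c = x + ?n *\<^sub>R y"
      using n by (simp add: scaleR_add_right)
    then have "?n *\<^sub>R y = (?n + 1) *\<^sub>R c - x" by simp
    then have "(1 / ?n) *\<^sub>R (?n *\<^sub>R y) = (1 / ?n) *\<^sub>R ((?n + 1) *\<^sub>R c - x)" by simp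
    then have "y = c - (1 / ?n) *\<^sub>R (x - c)"
      using n by (simp add: algebra_simps add_divide_distrib)
    then show ?thesis using y by simp
  qed
  then show thesis using c(1) that by blast
qed

section \<open>Asymmetric norms, volume bounds and finite nets\<close>

text \<open>This models the gauge of a convex body about an interior point, and
  \<open>cb x r\<close> is its homothet centred at \<open>x\<close>. Since \<open>p\<close> need not
  be symmetric, the order in \<open>p (y - x)\<close> matters, and each reversal costs a factor
  \<kappa>.\<close>

locale asym_norm =
  fixes p :: "'a::euclidean_space \<Rightarrow> real" and \<kappa> :: real
  assumes scale: "0 \<le> t \<Longrightarrow> p (t *\<^sub>R x) = t * p x"
    and tri: "p (x + y) \<le> p x + p y"
    and asym: "p (- x) \<le> \<kappa> * p x"
    and \<kappa>1: "\<kappa> \<ge> 1"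
    and lower: "\<exists>b>0. \<forall>x. b * norm x \<le> p x"
    and upper: "\<exists>B. \<forall>x. p x \<le> B * norm x"
begin

abbreviation cb :: "'a \<Rightarrow> real \<Rightarrow> 'a set" where
  "cb x r \<equiv> {y. p (y - x) \<le> r}"

lemma nonneg: "p x \<ge> 0"
  using lower by (metis mult_nonneg_nonneg norm_ge_zero order.trans less_imp_le)

lemma zero [simp]: "p 0 = 0"
  using scale[of 0 0] by simp

lemma tri3: "p (x - z) \<le> p (x - y) + p (y - z)"
  using tri[of "x - y" "y - z"] by simp

lemma continuous: "continuous_on UNIV p"
proof -
  obtain B where B: "\<And>x. p x \<le> B * norm x" using upper by blast
  have "\<bar>p x - p y\<bar> \<le> B * norm (x - y)" for x y
    using tri[of "x - y" y] tri[of "y - x" x] B[of "x - y"] B[of "y - x"]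
    by (simp add: norm_minus_commute abs_le_iff)
  then have lip: "dist (p x) (p y) \<le> B * dist x y" for x y
    by (simp add: dist_norm)
  have "dist (p x) (p y) \<le> (\<bar>B\<bar>) * dist x y" for x y
    using lip[of x y] mult_right_mono[OF abs_ge_self[of B] zero_le_dist[of x y]] by linarith
  then have "(\<bar>B\<bar>)-lipschitz_on UNIV p" by (intro lipschitz_onI) auto
  then show ?thesis by (rule lipschitz_on_continuous_on)
qed

lemma compact_cb: "compact (cb x r)"
proof -
  obtain b where b: "b > 0" "\<And>x. b * norm x \<le> p x" using lower by blast
  have "closed (cb x r)"
    by (intro closed_Collect_le continuous_intros continuous_on_compose2[OF continuous]) auto
  moreover have "bounded (cb x r)"
  proof -
    have "norm y \<le> norm x + r / b" if "y \<in> cb x r" for y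
    proof -
      have "b * norm (y - x) \<le> r" using b(2)[of "y - x"] that by simp
      then have "norm (y - x) \<le> r / b" using b by (simp add: field_simps)
      then show ?thesis using norm_triangle_sub[of y x] by linarith
    qed
    then show ?thesis by (auto intro: boundedI)
  qed
  ultimately show ?thesis using compact_eq_bounded_closed by blast
qed

text \<open>Volume comparison with the symmetrised ball \<open>L\<close>. A common point of
  \<open>u + L\<close> and \<open>v + L\<close> would make both \<open>p (u - v)\<close> and
  \<open>p (v - u)\<close> at most \<open>e\<close>, so the translates are disjoint. All of them lie
  in \<open>W *\<^sub>R L\<close>; the factor \<kappa> in \<open>W\<close> pays for bounding
  \<open>p (- z)\<close> by \<open>p z\<close>.\<close>

lemma separated_card_bound:
  assumes "finite U" "0 < e" "0 \<le> R"
    and U: "\<And>u. u \<in> U \<Longrightarrow> p u \<le> R"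
    and sep: "\<And>u v. u \<in> U \<Longrightarrow> v \<in> U \<Longrightarrow> u \<noteq> v \<Longrightarrow> p (u - v) > e \<or> p (v - u) > e"
  shows "real (card U) \<le> (\<kappa> * (2 * R / e + 1)) ^ DIM('a)"
proof -
  define W where "W = \<kappa> * (2 * R / e + 1)"
  have k: "W > 0" unfolding W_def using \<kappa>1 \<open>0 < e\<close> \<open>0 \<le> R\<close> by (intro mult_pos_pos add_nonneg_pos) auto
  define L where "L = {x. p x \<le> e / 2} \<inter> {x. p (- x) \<le> e / 2}"
  have cL: "compact L"
  proof -
    have "closed {x. p (- x) \<le> e / 2}"
      by (intro closed_Collect_le continuous_intros continuous_on_compose2[OF continuous]) auto
    then show ?thesis
      unfolding L_def using compact_cb[of 0 "e / 2"] by (intro compact_Int_closed) auto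
  qed
  obtain B where B: "\<And>x. p x \<le> B * norm x" using upper by blast
  define d where "d = e / (2 * (\<bar>B\<bar> + 1))"
  have d: "d > 0" using assms by (simp add: d_def)
  have "p x \<le> e / 2" if "norm x \<le> d" for x
  proof -
    have "p x \<le> \<bar>B\<bar> * norm x"
      using B[of x] mult_right_mono[OF abs_ge_self[of B] norm_ge_zero[of x]] by linarith
    also have "\<dots> \<le> (\<bar>B\<bar> + 1) * d" using that by (intro mult_mono) auto
    also have "\<dots> = e / 2" by (simp add: d_def divide_simps)
    finally show ?thesis .
  qed
  then have "ball 0 d \<subseteq> L" by (auto simp: L_def)
  have Lm: "L \<in> lmeasurable" using cL by (rule lmeasurable_compact)
  have "0 < measure lebesgue (ball (0::'a) d)" using d by (simp add: content_ball_pos)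
  also have "\<dots> \<le> measure lebesgue L"
    using \<open>ball 0 d \<subseteq> L\<close> Lm by (intro measure_mono_fmeasurable) auto
  finally have Lpos: "measure lebesgue L > 0" .
  have "real (card U) * measure lebesgue L = (\<Sum>u\<in>U. measure lebesgue ((+) u ` L))"
    by (simp add: measure_translation)
  also have "\<dots> = measure lebesgue (\<Union>u\<in>U. (+) u ` L)"
  proof (rule measure_UNION'[symmetric])
    show "(+) u ` L \<in> lmeasurable" for u
      using cL by (intro lmeasurable_compact compact_translation)
    show "pairwise (\<lambda>i j. disjnt ((+) i ` L) ((+) j ` L)) U"
    proof (rule pairwiseI, rule ccontr)
      fix u v assume uv: "u \<in> U" "v \<in> U" "u \<noteq> v" "\<not> disjnt ((+) u ` L) ((+) v ` L)"
      then obtain x y where xy: "x \<in> L" "y \<in> L" "u + x = v + y"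
        unfolding disjnt_def by blast
      then have "u - v = y + - x" "v - u = x + - y" by (auto simp: algebra_simps)
      then have "p (u - v) \<le> e" "p (v - u) \<le> e"
        using tri[of y "-x"] tri[of x "-y"] xy by (auto simp: L_def)
      then show False using sep[OF uv(1-3)] by auto
    qed
  qed (use assms in auto)
  also have "\<dots> \<le> measure lebesgue ((\<lambda>x. W *\<^sub>R x + 0) ` L)"
  proof (rule measure_mono_fmeasurable)
    show "(\<Union>u\<in>U. (+) u ` L) \<subseteq> (\<lambda>x. W *\<^sub>R x + 0) ` L"
    proof
      fix z assume "z \<in> (\<Union>u\<in>U. (+) u ` L)"
      then obtain u x where "u \<in> U" "x \<in> L" "z = u + x" by blast
      then have pz: "p z \<le> R + e / 2" using tri[of u x] U by (fastforce simp: L_def)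
      have "1 * (R + e / 2) \<le> \<kappa> * (R + e / 2)"
        using \<kappa>1 \<open>0 < e\<close> \<open>0 \<le> R\<close> by (intro mult_right_mono) auto
      then have "p z \<le> \<kappa> * (R + e / 2)" using pz by (metis mult_1 order_trans)
      moreover have "p (- z) \<le> \<kappa> * (R + e / 2)"
        using order_trans[OF asym[of z] mult_left_mono[OF pz, of \<kappa>]] \<kappa>1 by simp
      moreover have "\<kappa> * (R + e / 2) = W * (e / 2)"
        using \<open>0 < e\<close> by (simp add: W_def field_simps)
      ultimately have "p z \<le> W * (e / 2)" "p (- z) \<le> W * (e / 2)" by simp_all
      then have "(1 / W) *\<^sub>R z \<in> L"
        using k scale[of "1 / W" z] scale[of "1 / W" "- z"]
        by (simp add: L_def pos_divide_le_eq mult.commute)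
      moreover have "z = W *\<^sub>R ((1 / W) *\<^sub>R z) + 0"
        using k by simp
      ultimately show "z \<in> (\<lambda>x. W *\<^sub>R x + 0) ` L" by blast
    qed
    show "(\<Union>u\<in>U. (+) u ` L) \<in> sets lebesgue"
      using assms cL by (intro fmeasurableD lmeasurable_compact compact_UN compact_translation) auto
    show "(\<lambda>x. W *\<^sub>R x + 0) ` L \<in> lmeasurable"
      using cL by (simp add: lmeasurable_compact compact_scaling)
  qed
  also have "\<dots> = W ^ DIM('a) * measure lebesgue L"
    using k by (subst measure_lebesgue_affine) simp
  finally show ?thesis using Lpos by (simp add: W_def)
qed

text \<open>A separated set of largest cardinality is a net, since a point far from all its members
  could be added. The largest cardinality exists by \<open>separated_card_bound\<close>.\<close>

lemma finite_net:
  assumes "0 < e" "0 \<le> R"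
  obtains U where "finite U" "real (card U) \<le> (\<kappa> * (2 * R / e + 1)) ^ DIM('a)"
    "\<And>x. p x \<le> R \<Longrightarrow> \<exists>u\<in>U. p (x - u) \<le> e \<and> p (u - x) \<le> e"
proof -
  define P where "P U \<longleftrightarrow> finite U \<and> (\<forall>u\<in>U. p u \<le> R) \<and>
    (\<forall>u\<in>U. \<forall>v\<in>U. u \<noteq> v \<longrightarrow> p (u - v) > e \<or> p (v - u) > e)" for U
  have bd: "real (card U) \<le> (\<kappa> * (2 * R / e + 1)) ^ DIM('a)" if "P U" for U
    using that assms unfolding P_def by (intro separated_card_bound) auto
  have "P {}" by (simp add: P_def)
  moreover have "\<forall>U. P U \<longrightarrow> card U \<le> nat \<lfloor>(\<kappa> * (2 * R / e + 1)) ^ DIM('a)\<rfloor>"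
    using bd by (simp add: le_nat_floor)
  ultimately obtain U where U: "P U" "\<And>V. P V \<Longrightarrow> card V \<le> card U"
    using ex_has_greatest_nat[of P "{}" card] by (metis less_Suc_eq_le)
  have "\<exists>u\<in>U. p (x - u) \<le> e \<and> p (u - x) \<le> e" if x: "p x \<le> R" for x
  proof (rule ccontr)
    assume far: "\<not> ?thesis"
    then have out: "p (x - u) > e \<or> p (u - x) > e" if "u \<in> U" for u using that by (meson not_le)
    then have "P (insert x U)" using U(1) x unfolding P_def by blast
    then have "card (insert x U) \<le> card U" by (rule U(2))
    moreover have "x \<notin> U" using out[of x] assms by auto
    ultimately show False using U(1) by (simp add: P_def)
  qed
  then show thesis using that U(1) bd P_def by blast
qed

end

section \<open>Combinatorial covering and greedy selection\<close>

lemma finite_subcover_from_cells: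
  fixes D :: "'a \<Rightarrow> 'a set"
  assumes "finite I" "\<And>x. x \<in> S \<Longrightarrow> \<exists>i\<in>I. x \<in> T i"
    and "\<And>i. i \<in> I \<Longrightarrow> S \<inter> T i \<noteq> {} \<Longrightarrow> \<exists>x\<in>S. S \<inter> T i \<subseteq> D x"
  obtains F where "F \<subseteq> S" "finite F" "card F \<le> card I" "S \<subseteq> (\<Union>x\<in>F. D x)"
proof -
  define I' where "I' = {i\<in>I. S \<inter> T i \<noteq> {}}"
  have "\<forall>i\<in>I'. \<exists>x. x \<in> S \<and> S \<inter> T i \<subseteq> D x" using assms(3) unfolding I'_def by blast
  then obtain f where f: "\<And>i. i \<in> I' \<Longrightarrow> f i \<in> S \<and> S \<inter> T i \<subseteq> D (f i)" by metis
  show thesis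
  proof
    show "f ` I' \<subseteq> S" using f by blast
    show "finite (f ` I')" using assms(1) by (simp add: I'_def)
    have "card (f ` I') \<le> card I'" using assms(1) by (intro card_image_le) (simp add: I'_def)
    also have "\<dots> \<le> card I" using assms(1) by (intro card_mono) (auto simp: I'_def)
    finally show "card (f ` I') \<le> card I" .
    show "S \<subseteq> (\<Union>x\<in>f ` I'. D x)"
    proof
      fix x assume x: "x \<in> S"
      then obtain i where "i \<in> I" "x \<in> T i" using assms(2) by blast
      then show "x \<in> (\<Union>x\<in>f ` I'. D x)" using f[of i] x unfolding I'_def by blast
    qed
  qed
qed

text \<open>Induction on the largest size of a disjoint subfamily. The infimum of the sizes need not
  be attained, so \<open>y\<close> is chosen below twice the infimum, which is the source of the
  factor 2; positivity of \<open>s0\<close> makes this possible. Any disjoint family among the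
  members that miss \<open>D y\<close> can be enlarged by \<open>y\<close>, so the bound drops by
  one.\<close>

lemma greedy_smallest_first:
  fixes D :: "'a \<Rightarrow> 'b set" and s :: "'a \<Rightarrow> real"
  assumes "\<And>F. F \<subseteq> X \<Longrightarrow> finite F \<Longrightarrow> pairwise (\<lambda>x y. disjnt (D x) (D y)) F \<Longrightarrow> card F \<le> k"
    and "\<And>x. x \<in> X \<Longrightarrow> D x \<noteq> {}"
    and "s0 > 0" "\<And>x. x \<in> X \<Longrightarrow> s0 \<le> s x"
  shows "\<exists>F. F \<subseteq> X \<and> finite F \<and> pairwise (\<lambda>x y. disjnt (D x) (D y)) F \<and>
    (\<forall>x\<in>X. \<exists>y\<in>F. \<not> disjnt (D x) (D y) \<and> s y \<le> 2 * s x)"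
  using assms(1,2,4)
proof (induction k arbitrary: X)
  case 0
  have "x \<notin> X" for x using "0.prems"(1)[of "{x}"] by auto
  then show ?case by auto
next
  case (Suc k)
  show ?case
  proof (cases "X = {}")
    case False
    define i where "i = Inf (s ` X)"
    have bdd: "bdd_below (s ` X)" using Suc.prems(3) by (meson bdd_belowI2)
    have "s0 \<le> i" unfolding i_def using False Suc.prems(3) by (intro cINF_greatest)
    then have "i < 2 * i" using assms(3) by simp
    then obtain y where y: "y \<in> X" "s y < 2 * i"
      unfolding i_def using cINF_less_iff[OF False bdd] by auto
    have min: "s y \<le> 2 * s x" if "x \<in> X" for x
      using cINF_lower[OF bdd that] y by (simp add: i_def)
    define X' where "X' = {x\<in>X. disjnt (D x) (D y)}"
    have "\<exists>F. F \<subseteq> X' \<and> finite F \<and> pairwise (\<lambda>x y. disjnt (D x) (D y)) F \<and>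
      (\<forall>x\<in>X'. \<exists>y\<in>F. \<not> disjnt (D x) (D y) \<and> s y \<le> 2 * s x)"
    proof (rule Suc.IH)
      fix F assume F: "F \<subseteq> X'" "finite F" "pairwise (\<lambda>x y. disjnt (D x) (D y)) F"
      have "y \<notin> X'" using Suc.prems(2)[OF y(1)] by (auto simp: X'_def disjnt_def)
      then have "y \<notin> F" using F by blast
      have "card (insert y F) \<le> Suc k"
      proof (rule Suc.prems(1))
        show "pairwise (\<lambda>x y. disjnt (D x) (D y)) (insert y F)"
          using F by (auto simp: pairwise_insert X'_def disjnt_sym)
      qed (use F y in \<open>auto simp: X'_def\<close>)
      then show "card F \<le> k" using F \<open>y \<notin> F\<close> by simp
    qed (use Suc.prems in \<open>auto simp: X'_def\<close>)
    then obtain F where F: "F \<subseteq> X'" "finite F" "pairwise (\<lambda>x y. disjnt (D x) (D y)) F"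
      "\<forall>x\<in>X'. \<exists>y\<in>F. \<not> disjnt (D x) (D y) \<and> s y \<le> 2 * s x" by blast
    have "\<forall>x\<in>X. \<exists>y'\<in>insert y F. \<not> disjnt (D x) (D y') \<and> s y' \<le> 2 * s x"
      using F(4) min unfolding X'_def by blast
    moreover have "pairwise (\<lambda>x y. disjnt (D x) (D y)) (insert y F)"
      using F by (auto simp: pairwise_insert X'_def disjnt_sym)
    moreover have "insert y F \<subseteq> X" using F y by (auto simp: X'_def)
    ultimately show ?thesis using F(2) by (intro exI[of _ "insert y F"]) auto
  qed auto
qed

section \<open>Covering the centres of bodies that meet a small body\<close>

context asym_norm
begin

text \<open>Twice (near cells and far cones) the size of a net of the \<open>p\<close>-ball of radius \<open>2\<close>
  at resolution \<open>1 / (16 * \<kappa>)\<close>.\<close>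

definition cover_number :: real where
  "cover_number = 2 * (\<kappa> * (64 * \<kappa> + 1)) ^ DIM('a)"

lemma cover_number_ge1: "cover_number \<ge> 1"
proof -
  have "\<kappa> * (64 * \<kappa> + 1) \<ge> 1 * 1" using \<kappa>1 by (intro mult_mono) auto
  then have "(\<kappa> * (64 * \<kappa> + 1)) ^ DIM('a) \<ge> 1" by (simp add: one_le_power)
  then show ?thesis by (simp add: cover_number_def)
qed

text \<open>Here \<open>y\<close> is an almost farthest centre in a narrow cone with apex
  \<open>a\<close>, and \<open>s\<close> is its radius. Both centres are written as a length times a
  unit direction, and the directions differ by at most 1/4. Going from \<open>y\<close> to
  \<open>x\<close> thus splits into a radial move and a short sideways move.\<close>

lemma far_cone_absorbed:
  assumes far: "2 * \<rho> \<le> p (a - x)" "2 * \<rho> \<le> p (a - y)" and "\<rho> > 0"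
    and near_max: "p (a - x) \<le> (1 + 1 / (4 * \<kappa>)) * p (a - y)"
    and meets: "p (a - y) \<le> s + \<rho>"
    and cone: "p ((1 / p (a - y)) *\<^sub>R (a - y) - (1 / p (a - x)) *\<^sub>R (a - x)) \<le> 1 / 4"
  shows "p (x - y) \<le> s"
proof -
  define \<alpha> \<beta> where "\<alpha> = p (a - x)" and "\<beta> = p (a - y)"
  define v w where "v = (1 / \<alpha>) *\<^sub>R (a - x)" and "w = (1 / \<beta>) *\<^sub>R (a - y)"
  have pos: "\<alpha> > 0" "\<beta> > 0" using far \<open>\<rho> > 0\<close> by (auto simp: \<alpha>_def \<beta>_def)
  have xv: "a - x = \<alpha> *\<^sub>R v" and yw: "a - y = \<beta> *\<^sub>R w" using pos by (auto simp: v_def w_def)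
  have pv: "p v = 1" using scale[of "1 / \<alpha>" "a - x"] pos by (simp add: v_def \<alpha>_def)
  have pw: "p w = 1" using scale[of "1 / \<beta>" "a - y"] pos by (simp add: w_def \<beta>_def)
  have vw: "p (w - v) \<le> 1 / 4" using cone by (simp add: v_def w_def \<alpha>_def \<beta>_def)
  have xy: "x - y = \<beta> *\<^sub>R w - \<alpha> *\<^sub>R v" using xv yw by (simp add: algebra_simps)
  show ?thesis
  proof (cases "\<alpha> \<le> \<beta>")
    case True
    have "x - y = (\<beta> - \<alpha>) *\<^sub>R w + \<alpha> *\<^sub>R (w - v)" using xy by (simp add: algebra_simps)
    then have "p (x - y) \<le> p ((\<beta> - \<alpha>) *\<^sub>R w) + p (\<alpha> *\<^sub>R (w - v))" using tri by metis
    also have "\<dots> = (\<beta> - \<alpha>) + \<alpha> * p (w - v)" using True pos pw by (simp add: scale)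
    also have "\<dots> \<le> (\<beta> - \<alpha>) + \<alpha> * (1 / 4)" using vw pos by (intro add_left_mono mult_left_mono) auto
    \<comment> \<open>Because \<open>\<beta> - 3 * \<alpha> / 4\<close> is at most
      \<open>s + \<rho> - 3 * \<rho> / 2\<close>.\<close>
    also have "\<dots> \<le> s" using meets far \<open>\<rho> > 0\<close> by (simp add: \<alpha>_def \<beta>_def)
    finally show ?thesis .
  next
    case False
    have "x - y = (\<alpha> - \<beta>) *\<^sub>R (- v) + \<beta> *\<^sub>R (w - v)" using xy by (simp add: algebra_simps)
    then have "p (x - y) \<le> p ((\<alpha> - \<beta>) *\<^sub>R (- v)) + p (\<beta> *\<^sub>R (w - v))" using tri by metis
    also have "\<dots> = (\<alpha> - \<beta>) * p (- v) + \<beta> * p (w - v)"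
      using False pos scale[of "\<alpha> - \<beta>" "- v"] scale[of \<beta> "w - v"] by simp
    also have "\<dots> \<le> (\<alpha> - \<beta>) * \<kappa> + \<beta> * (1 / 4)"
      using vw pos False asym[of v] pv by (intro add_mono mult_left_mono) auto
    also have "\<dots> \<le> \<beta> / 4 + \<beta> / 4"
    proof -
      have "\<alpha> - \<beta> \<le> 1 / (4 * \<kappa>) * \<beta>"
        using near_max by (simp add: \<alpha>_def \<beta>_def algebra_simps)
      then have "(\<alpha> - \<beta>) * \<kappa> \<le> 1 / (4 * \<kappa>) * \<beta> * \<kappa>" using \<kappa>1 by (intro mult_right_mono) auto
      also have "\<dots> = \<beta> / 4" using \<kappa>1 by simp
      finally show ?thesis by simp
    qed
    \<comment> \<open>Half of \<beta> is at least \<rho>, so \<beta> \<le> s + \<rho> leaves at most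
      \<open>s\<close> for the other half.\<close>
    also have "\<dots> \<le> s" using meets far \<open>\<rho> > 0\<close> by (simp add: \<beta>_def)
    finally show ?thesis .
  qed
qed

text \<open>Centres closer than \<open>2 * \<rho>\<close> are sorted into cells that are small
  against every radius, by \<open>large\<close>, so any member of a cell covers it. The remaining
  centres are sorted into cones with apex \<open>a\<close>, and each cone is covered by the body of
  an almost farthest centre.\<close>

lemma cover_bodies_near_point:
  assumes "bounded S" "\<rho> > 0"
    and meets: "\<And>x. x \<in> S \<Longrightarrow> p (a - x) \<le> s x + \<rho>"
    and large: "\<And>x. x \<in> S \<Longrightarrow> \<rho> \<le> 2 * \<kappa> * s x"
  obtains F where "F \<subseteq> S" "finite F" "real (card F) \<le> cover_number" "S \<subseteq> (\<Union>x\<in>F. cb x (s x))"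
proof -
  \<comment> \<open>Two points of a cell are within \<open>2 * e\<close>. In a near cell this gives
    distance at most \<open>2 * e * \<rho>\<close>, hence at most
    \<open>4 * \<kappa> * e * s y = s y / 4\<close>; in a cone, \<open>2 * e\<close> stays below the
    1/4 of \<open>far_cone_absorbed\<close>.\<close>
  define e where "e = 1 / (16 * \<kappa>)"
  have e: "e > 0" "2 * e \<le> 1 / 4" "\<kappa> * e = 1 / 16" using \<kappa>1 by (auto simp: e_def field_simps)
  obtain U where U: "finite U" "real (card U) \<le> (\<kappa> * (2 * 2 / e + 1)) ^ DIM('a)"
    "\<And>x. p x \<le> 2 \<Longrightarrow> \<exists>u\<in>U. p (x - u) \<le> e \<and> p (u - x) \<le> e"
    using finite_net[of e 2] e by auto
  define cell where "cell u x \<longleftrightarrow> p (x - u) \<le> e \<and> p (u - x) \<le> e" for u x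
  have cell: "p (x - y) \<le> 2 * e" if "cell u x" "cell u y" for u x y
    using that tri3[of x y u] by (simp add: cell_def)
  \<comment> \<open>Near centres are rescaled by the fixed length \<rho>, giving cells; far ones by
    their own distance from \<open>a\<close>, giving cones. The boolean accounts for the leading
    factor 2 of \<open>cover_number\<close>.\<close>
  define T where "T i = (case i of (True, u) \<Rightarrow> {x. p (a - x) < 2 * \<rho> \<and> cell u ((1 / \<rho>) *\<^sub>R (a - x))}
    | (False, u) \<Rightarrow> {x. p (a - x) \<ge> 2 * \<rho> \<and> cell u ((1 / p (a - x)) *\<^sub>R (a - x))})" for i
  have cov: "\<exists>i\<in>UNIV \<times> U. x \<in> T i" for x
  proof (cases "p (a - x) < 2 * \<rho>")
    case True
    have "p ((1 / \<rho>) *\<^sub>R (a - x)) = p (a - x) / \<rho>"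
      using assms(2) scale[of "1 / \<rho>" "a - x"] by simp
    then have "p ((1 / \<rho>) *\<^sub>R (a - x)) \<le> 2"
      using True assms(2) by (simp add: pos_divide_le_eq)
    then obtain u where "u \<in> U" "cell u ((1 / \<rho>) *\<^sub>R (a - x))" using U(3) cell_def by blast
    then show ?thesis using True by (intro bexI[of _ "(True, u)"]) (auto simp: T_def)
  next
    case False
    then have "p (a - x) > 0" using assms(2) by linarith
    then have "p ((1 / p (a - x)) *\<^sub>R (a - x)) \<le> 2"
      using scale[of "1 / p (a - x)" "a - x"] by simp
    then obtain u where "u \<in> U" "cell u ((1 / p (a - x)) *\<^sub>R (a - x))" using U(3) cell_def by blast
    then show ?thesis using False by (intro bexI[of _ "(False, u)"]) (auto simp: T_def)
  qed
  have one: "\<exists>y\<in>S. S \<inter> T (b, u) \<subseteq> cb y (s y)" if ne: "S \<inter> T (b, u) \<noteq> {}" for b u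
  proof (cases b)
    case True
    obtain y where y: "y \<in> S" "y \<in> T (b, u)" using ne by blast
    have "p (x - y) \<le> s y" if x: "x \<in> S" "x \<in> T (b, u)" for x
    proof -
      have c: "p ((1 / \<rho>) *\<^sub>R (a - y) - (1 / \<rho>) *\<^sub>R (a - x)) \<le> 2 * e"
        using x y True by (intro cell[of u]) (auto simp: T_def)
      have "x - y = \<rho> *\<^sub>R ((1 / \<rho>) *\<^sub>R (a - y) - (1 / \<rho>) *\<^sub>R (a - x))"
        using assms(2) by (simp add: algebra_simps)
      then have "p (x - y) \<le> \<rho> * (2 * e)"
        using scale[of \<rho>] mult_left_mono[OF c, of \<rho>] assms(2) by simp
      also have "\<dots> \<le> (2 * \<kappa> * s y) * (2 * e)" using large[OF y(1)] e by (intro mult_right_mono) auto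
      also have "\<dots> = 4 * (\<kappa> * e) * s y" by simp
      also have "\<dots> = s y / 4" unfolding e(3) by simp
      finally have "p (x - y) \<le> s y / 4" .
      moreover have "s y \<ge> 0"
        using large[OF y(1)] assms(2) \<kappa>1 zero_less_mult_iff[of "2 * \<kappa>" "s y"] by linarith
      ultimately show ?thesis by linarith
    qed
    then show ?thesis using y(1) by blast
  next
    case False
    let ?A = "(\<lambda>x. p (a - x)) ` (S \<inter> T (b, u))"
    have bdd: "bdd_above ?A"
    proof -
      have "compact ((\<lambda>x. p (a - x)) ` closure S)"
        using assms(1) by (intro compact_continuous_image continuous_on_compose2[OF continuous] continuous_intros)
          (auto simp: compact_closure)
      then have "bdd_above ((\<lambda>x. p (a - x)) ` closure S)"
        by (intro bounded_imp_bdd_above compact_imp_bounded)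
      moreover have "?A \<subseteq> (\<lambda>x. p (a - x)) ` closure S"
        using closure_subset[of S] by blast
      ultimately show ?thesis by (rule bdd_above_mono)
    qed
    define m where "m = Sup ?A"
    have up: "p (a - x) \<le> m" if "x \<in> S \<inter> T (b, u)" for x
      unfolding m_def using cSUP_upper[OF that bdd] .
    have mpos: "m > 0"
    proof -
      obtain x where x: "x \<in> S \<inter> T (b, u)" using ne by blast
      then have "p (a - x) \<ge> 2 * \<rho>" using False by (simp add: T_def)
      then show ?thesis using up[OF x] assms(2) by linarith
    qed
    \<comment> \<open>The supremum need not be attained; a centre within the factor \<open>w\<close>
      of it meets the hypothesis \<open>near_max\<close>.\<close>
    define w where "w = 1 + 1 / (4 * \<kappa>)"
    have k1: "w > 1" using \<kappa>1 by (simp add: w_def)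
    then have "m / w < m" using mpos by (simp add: pos_divide_less_eq)
    then obtain y where y: "y \<in> S" "y \<in> T (b, u)" "m / w < p (a - y)"
      unfolding m_def using less_cSUP_iff[OF ne bdd] by auto
    have "p (x - y) \<le> s y" if x: "x \<in> S" "x \<in> T (b, u)" for x
    proof (rule far_cone_absorbed[where a = a and \<rho> = \<rho>])
      show "2 * \<rho> \<le> p (a - x)" "2 * \<rho> \<le> p (a - y)" using x y False by (auto simp: T_def)
      show "\<rho> > 0" by fact
      have "m \<le> w * p (a - y)"
        using y(3) k1 by (simp add: pos_divide_less_eq mult.commute)
      then show "p (a - x) \<le> (1 + 1 / (4 * \<kappa>)) * p (a - y)"
        using up[of x] x unfolding w_def by (meson IntI order_trans)
      show "p (a - y) \<le> s y + \<rho>" using meets y by simp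
      have "p ((1 / p (a - y)) *\<^sub>R (a - y) - (1 / p (a - x)) *\<^sub>R (a - x)) \<le> 2 * e"
        using x y False by (intro cell[of u]) (auto simp: T_def)
      then show "p ((1 / p (a - y)) *\<^sub>R (a - y) - (1 / p (a - x)) *\<^sub>R (a - x)) \<le> 1 / 4"
        using e by linarith
    qed
    then show ?thesis using y(1) by blast
  qed
  obtain F where F: "F \<subseteq> S" "finite F" "card F \<le> card ((UNIV :: bool set) \<times> U)" "S \<subseteq> (\<Union>x\<in>F. cb x (s x))"
  proof (rule finite_subcover_from_cells[of "UNIV \<times> U" S T "\<lambda>x. cb x (s x)"])
    show "\<exists>y\<in>S. S \<inter> T i \<subseteq> cb y (s y)" if "S \<inter> T i \<noteq> {}" for i
      using one[of "fst i" "snd i"] that by simp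
  qed (use U(1) cov in auto)
  have "real (card F) \<le> 2 * real (card U)"
    using F(3) by (simp add: card_cartesian_product)
  also have "\<dots> \<le> 2 * (\<kappa> * (2 * 2 / e + 1)) ^ DIM('a)" using U(2) by simp
  also have "\<dots> = cover_number" by (simp add: cover_number_def e_def)
  finally show thesis using that F by blast
qed

end

section \<open>Homothets of prescribed measure\<close>

lemma (in asym_norm) pos: "x \<noteq> 0 \<Longrightarrow> p x > 0"
  using lower by (metis mult_pos_pos zero_less_norm_iff less_le_trans)

text \<open>Moving a point of the sphere radially away from \<open>x\<close> increases
  \<open>p\<close> at once, so the point is not interior. This is how null frontiers give null
  spheres.\<close>

lemma (in asym_norm) sphere_subset_frontier:
  assumes "r > 0"
  shows "{y. p (y - x) = r} \<subseteq> frontier (cb x r)"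
proof
  fix y assume "y \<in> {y. p (y - x) = r}"
  then have y: "p (y - x) = r" by simp
  have "y \<notin> interior (cb x r)"
  proof
    assume "y \<in> interior (cb x r)"
    then obtain e where e: "e > 0" "cball y e \<subseteq> cb x r"
      unfolding mem_interior_cball by blast
    have "y \<noteq> x" using y assms by auto
    define t where "t = e / norm (y - x)"
    have t: "t > 0" using e \<open>y \<noteq> x\<close> by (simp add: t_def)
    have "y + t *\<^sub>R (y - x) \<in> cball y e"
      using e \<open>y \<noteq> x\<close> by (simp add: t_def dist_norm)
    then have "p (y + t *\<^sub>R (y - x) - x) \<le> r" using e by blast
    moreover have "y + t *\<^sub>R (y - x) - x = (1 + t) *\<^sub>R (y - x)" by (simp add: algebra_simps)
    ultimately have "(1 + t) * r \<le> r" using scale[of "1 + t" "y - x"] t y by simp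
    then show False using t assms by (simp add: algebra_simps mult_le_0_iff)
  qed
  moreover have "y \<in> closure (cb x r)" using y closure_subset by fastforce
  ultimately show "y \<in> frontier (cb x r)" by (simp add: frontier_def)
qed

text \<open>An intermediate value argument at the infimum \<open>r0\<close> of the radii whose mass
  reaches \<open>c\<close>. Continuity of measure from above gives mass at least \<open>c\<close> at
  \<open>r0\<close>; continuity from below, together with the null frontier, gives at most
  \<open>c\<close>.\<close>

lemma (in asym_norm) exists_radius:
  fixes M :: "'a measure"
  assumes sets: "sets M = sets borel"
    and fin: "\<And>K. compact K \<Longrightarrow> emeasure M K < \<infinity>"
    and frontier: "\<And>x r. r > 0 \<Longrightarrow> emeasure M (frontier (cb x r)) = 0"
    and point: "emeasure M {x} = 0"
    and c: "0 < c" "c < emeasure M UNIV"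
  shows "\<exists>r>0. emeasure M (cb x r) = c"
proof -
  let ?f = "\<lambda>r. emeasure M (cb x r)"
  have meas: "cb x r \<in> sets M" for r
    using sets compact_cb borel_compact by blast
  have mono: "?f r \<le> ?f t" if "r \<le> t" for r t
    using that meas by (intro emeasure_mono) auto
  define A where "A = {r. 0 \<le> r \<and> c \<le> ?f r}"
  have "\<exists>n::nat. c < ?f (real n)"
  proof -
    have "(\<Union>n::nat. cb x (real n)) = UNIV"
      using real_arch_simple by auto
    moreover have "(SUP n::nat. ?f (real n)) = emeasure M (\<Union>n::nat. cb x (real n))"
    proof (rule SUP_emeasure_incseq)
      show "incseq (\<lambda>n::nat. cb x (real n))"
        by (auto simp: incseq_def intro: order_trans)
    qed (use meas in auto)
    ultimately have "c < (SUP n::nat. ?f (real n))" using c(2) by simp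
    then show ?thesis unfolding less_SUP_iff by blast
  qed
  then obtain n :: nat where "c < ?f (real n)" by blast
  then have "real n \<in> A" unfolding A_def by (simp add: less_imp_le)
  then have ne: "A \<noteq> {}" by blast
  have bdd: "bdd_below A" by (auto simp: A_def intro: bdd_belowI[of _ 0])
  define r0 where "r0 = Inf A"
  have r0: "r0 \<ge> 0" unfolding r0_def using ne by (intro cInf_greatest) (auto simp: A_def)
  have ge: "c \<le> ?f r0"
  proof -
    have "(\<Inter>n. cb x (r0 + 1 / real (Suc n))) = cb x r0"
    proof (intro equalityI subsetI)
      fix y assume y: "y \<in> (\<Inter>n. cb x (r0 + 1 / real (Suc n)))"
      have "(\<lambda>n. r0 + 1 / real (Suc n)) \<longlonglongrightarrow> r0 + 0"
        by (intro tendsto_intros LIMSEQ_Suc lim_1_over_n)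
      then have "p (y - x) \<le> r0 + 0" using y by (intro LIMSEQ_le_const) auto
      then show "y \<in> cb x r0" by simp
    qed (auto intro: order_trans)
    moreover have "(INF n. ?f (r0 + 1 / real (Suc n))) = emeasure M (\<Inter>n. cb x (r0 + 1 / real (Suc n)))"
    proof (rule INF_emeasure_decseq)
      show "decseq (\<lambda>n. cb x (r0 + 1 / real (Suc n)))"
      proof (rule decseq_SucI, safe)
        fix n y assume "p (y - x) \<le> r0 + 1 / real (Suc (Suc n))"
        moreover have "1 / real (Suc (Suc n)) \<le> 1 / real (Suc n)" by (intro divide_left_mono) auto
        ultimately show "p (y - x) \<le> r0 + 1 / real (Suc n)" by linarith
      qed
      show "?f (r0 + 1 / real (Suc n)) \<noteq> \<infinity>" for n
        using fin[OF compact_cb[of x "r0 + 1 / real (Suc n)"]] by simp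
    qed (use meas in auto)
    moreover have "c \<le> (INF n. ?f (r0 + 1 / real (Suc n)))"
    proof (rule INF_greatest)
      fix n
      have "r0 < r0 + 1 / real (Suc n)" by simp
      then obtain r where "r \<in> A" "r < r0 + 1 / real (Suc n)"
        unfolding r0_def using cInf_less_iff[OF ne bdd] by blast
      then show "c \<le> ?f (r0 + 1 / real (Suc n))"
        using mono[of r "r0 + 1 / real (Suc n)"] unfolding A_def by (auto intro: order_trans)
    qed
    ultimately show ?thesis by simp
  qed
  \<comment> \<open>The ball of radius 0 is a single point, which is null.\<close>
  have "r0 \<noteq> 0"
  proof
    assume "r0 = 0"
    moreover have "y = x" if "p (y - x) \<le> 0" for y using that pos[of "y - x"] by fastforce
    then have "cb x 0 = {x}" by auto
    ultimately show False using ge point c by simp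
  qed
  with r0 have r0pos: "r0 > 0" by simp
  have le: "?f r0 \<le> c"
  proof -
    let ?I = "\<Union>n. cb x (r0 - 1 / real (Suc n))"
    have sub: "cb x r0 \<subseteq> ?I \<union> frontier (cb x r0)"
    proof
      fix y assume y: "y \<in> cb x r0"
      show "y \<in> ?I \<union> frontier (cb x r0)"
      proof (cases "p (y - x) = r0")
        case True
        then show ?thesis using sphere_subset_frontier[OF r0pos, of x] by blast
      next
        case False
        then have "r0 - p (y - x) > 0" using y by simp
        then obtain n where "inverse (real (Suc n)) < r0 - p (y - x)" using reals_Archimedean by blast
        then have "y \<in> cb x (r0 - 1 / real (Suc n))" by (simp add: inverse_eq_divide)
        then show ?thesis by blast
      qed
    qed
    have fr: "frontier (cb x r0) \<in> sets M"
      unfolding sets by (rule borel_closed[OF frontier_closed])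
    have I: "?I \<in> sets M" using meas by blast
    have "?f r0 \<le> emeasure M (?I \<union> frontier (cb x r0))"
      using sub fr I by (intro emeasure_mono) auto
    also have "\<dots> \<le> emeasure M ?I + emeasure M (frontier (cb x r0))"
      using fr I by (intro emeasure_subadditive)
    also have "\<dots> = emeasure M ?I" using frontier[OF r0pos] by simp
    also have "\<dots> = (SUP n. ?f (r0 - 1 / real (Suc n)))"
    proof (rule SUP_emeasure_incseq[symmetric])
      show "incseq (\<lambda>n. cb x (r0 - 1 / real (Suc n)))"
      proof (rule incseq_SucI, safe)
        fix n y assume "p (y - x) \<le> r0 - 1 / real (Suc n)"
        moreover have "1 / real (Suc (Suc n)) \<le> 1 / real (Suc n)" by (intro divide_left_mono) auto
        ultimately show "p (y - x) \<le> r0 - 1 / real (Suc (Suc n))" by linarith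
      qed
    qed (use meas in auto)
    also have "\<dots> \<le> c"
    proof (rule SUP_least)
      fix n
      let ?r = "r0 - 1 / real (Suc n)"
      show "?f ?r \<le> c"
      \<comment> \<open>For small \<open>n\<close> the radius can be negative, and then the set is
        empty.\<close>
      proof (cases "?r \<ge> 0")
        case True
        have "?r \<notin> A"
          using cInf_lower[OF _ bdd, of ?r] unfolding r0_def[symmetric] by fastforce
        then show ?thesis using True unfolding A_def by auto
      next
        case False
        then have "cb x ?r = {}" using nonneg by (force dest: order_trans[OF nonneg])
        then show ?thesis by simp
      qed
    qed
    finally show ?thesis .
  qed
  show ?thesis using r0pos ge le by (intro exI[of _ r0]) auto
qed

section \<open>Disjoint families of bodies of equal mass\<close>

text \<open>One radius is fixed for every centre, so that families of bodies can be handled as sets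
  of centres.\<close>

locale equal_mass_bodies = asym_norm +
  fixes M :: "'a::euclidean_space measure" and m :: real and s :: "'a \<Rightarrow> real"
  assumes sets_M: "sets M = sets borel"
    and fin: "\<And>K. compact K \<Longrightarrow> emeasure M K < \<infinity>"
    and point: "\<And>x. emeasure M {x} = 0"
    and m_pos: "m > 0"
    and s_pos: "\<And>x. s x > 0"
    and mass: "\<And>x. emeasure M (cb x (s x)) = ennreal m"
begin

abbreviation body :: "'a \<Rightarrow> 'a set" where
  "body x \<equiv> cb x (s x)"

abbreviation separated :: "'a set \<Rightarrow> bool" where
  "separated F \<equiv> pairwise (\<lambda>x y. disjnt (body x) (body y)) F"

lemma center_in_body: "x \<in> body x"
  using s_pos[of x] by simp

lemma body_sets: "body x \<in> sets M"
  using sets_M compact_cb borel_compact by blast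

text \<open>Points are null, so every point has a ball of mass below \<open>m\<close>. By
  compactness one Euclidean radius \<open>e\<close> works for all of \<open>X\<close>, and a body
  too small to leave such a ball could not have mass \<open>m\<close>.\<close>

lemma radii_bounded_below:
  assumes "bounded X"
  obtains s0 where "s0 > 0" "\<And>x. x \<in> X \<Longrightarrow> s0 \<le> s x"
proof -
  have small: "\<exists>d>0. emeasure M (ball x d) < ennreal m" for x
  proof -
    have "(\<Inter>n. cball x (1 / real (Suc n))) = {x}"
    proof (intro equalityI subsetI)
      fix y assume y: "y \<in> (\<Inter>n. cball x (1 / real (Suc n)))"
      have "(\<lambda>n. 1 / real (Suc n)) \<longlonglongrightarrow> 0" by (intro LIMSEQ_Suc lim_1_over_n)
      then have "dist x y \<le> 0" using y by (intro LIMSEQ_le_const) auto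
      then show "y \<in> {x}" by simp
    qed auto
    moreover have "(INF n. emeasure M (cball x (1 / real (Suc n)))) = emeasure M (\<Inter>n. cball x (1 / real (Suc n)))"
    proof (rule INF_emeasure_decseq)
      show "range (\<lambda>n. cball x (1 / real (Suc n))) \<subseteq> sets M" unfolding sets_M by auto
      show "decseq (\<lambda>n. cball x (1 / real (Suc n)))"
        by (rule decseq_SucI, rule subset_cball) (intro divide_left_mono, auto)
      show "emeasure M (cball x (1 / real (Suc n))) \<noteq> \<infinity>" for n
        using fin[OF compact_cball, of x "1 / real (Suc n)"] by simp
    qed
    ultimately have "(INF n. emeasure M (cball x (1 / real (Suc n)))) < ennreal m"
      using point m_pos by simp
    then obtain n where n: "emeasure M (cball x (1 / real (Suc n))) < ennreal m"
      unfolding INF_less_iff by blast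
    have "emeasure M (ball x (1 / real (Suc n))) \<le> emeasure M (cball x (1 / real (Suc n)))"
      using ball_subset_cball by (intro emeasure_mono) (auto simp: sets_M)
    then show ?thesis using n by (intro exI[of _ "1 / real (Suc n)"]) (auto intro: le_less_trans)
  qed
  define \<G> where "\<G> = {G. open G \<and> emeasure M G < ennreal m}"
  have "closure X \<subseteq> \<Union>\<G>" using small unfolding \<G>_def by (fastforce intro: centre_in_ball[THEN iffD2])
  moreover have "compact (closure X)" using assms by (simp add: compact_closure)
  moreover have "open G" if "G \<in> \<G>" for G using that by (simp add: \<G>_def)
  \<comment> \<open>This \<open>e\<close> is a Lebesgue number of the open cover.\<close>
  ultimately obtain e where e: "e > 0" "\<And>x. x \<in> closure X \<Longrightarrow> \<exists>G\<in>\<G>. ball x e \<subseteq> G"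
    using Heine_Borel_lemma[of "closure X" \<G>] by blast
  obtain b where b: "b > 0" "\<And>x. b * norm x \<le> p x" using lower by blast
  have "b * e \<le> s x" if x: "x \<in> X" for x
  proof (rule ccontr)
    assume "\<not> b * e \<le> s x"
    then have lt: "s x < b * e" by simp
    obtain G where G: "G \<in> \<G>" "ball x e \<subseteq> G" using e(2)[of x] closure_subset[of X] x by blast
    have "body x \<subseteq> ball x e"
    proof
      fix y assume "y \<in> body x"
      then have "b * norm (y - x) < b * e" using b(2)[of "y - x"] lt by simp
      then show "y \<in> ball x e" using b(1) by (simp add: dist_norm norm_minus_commute)
    qed
    then have "emeasure M (body x) \<le> emeasure M G"
      using G by (intro emeasure_mono) (auto simp: \<G>_def sets_M)
    then have "ennreal m \<le> emeasure M G" by (simp only: mass)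
    moreover have "emeasure M G < ennreal m" using G by (simp add: \<G>_def)
    ultimately show False by (simp add: leD)
  qed
  then show thesis using that[of "b * e"] b e by simp
qed

text \<open>The factor \<kappa> comes from reversing the direction between \<open>a\<close> and a
  common point. Accordingly \<kappa> times a radius plays the role of \<rho> in
  \<open>cover_bodies_near_point\<close>.\<close>

lemma meeting_bodies:
  assumes "\<not> disjnt (body x) (cb a r)"
  shows "p (a - x) \<le> s x + \<kappa> * r"
proof -
  obtain z where z: "p (z - x) \<le> s x" "p (z - a) \<le> r"
    using assms by (auto simp: disjnt_def)
  have "p (a - z) \<le> \<kappa> * p (z - a)" using asym[of "z - a"] by simp
  also have "\<dots> \<le> \<kappa> * r" using z \<kappa>1 by (intro mult_left_mono) auto
  finally show ?thesis using tri3[of a x z] z by linarith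
qed

text \<open>All bodies have the same mass, so the count of \<open>G\<close> against \<open>F\<close>
  says that the selected bodies carry at least the fraction \<open>1 / cover_number\<close> of the
  mass of \<open>X\<close>, whenever \<open>X\<close> is measurable.\<close>

lemma separated_cover:
  assumes "bounded X"
  obtains F G where "F \<subseteq> X" "finite F" "separated F"
    "finite G" "real (card G) \<le> cover_number * real (card F)" "X \<subseteq> (\<Union>x\<in>G. body x)"
proof -
  obtain s0 where s0: "s0 > 0" "\<And>x. x \<in> X \<Longrightarrow> s0 \<le> s x" using radii_bounded_below[OF assms] by blast
  obtain R where R: "R \<ge> 0" "\<And>x. x \<in> X \<Longrightarrow> p x \<le> R"
  proof -
    obtain B where B: "\<And>x. p x \<le> B * norm x" using upper by blast
    obtain b where b: "\<And>x. x \<in> X \<Longrightarrow> norm x \<le> b" using assms bounded_iff by blast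
    have "p x \<le> \<bar>B\<bar> * \<bar>b\<bar>" if "x \<in> X" for x
    proof -
      have "p x \<le> \<bar>B\<bar> * norm x"
        using B[of x] mult_right_mono[OF abs_ge_self[of B] norm_ge_zero[of x]] by linarith
      also have "\<dots> \<le> \<bar>B\<bar> * \<bar>b\<bar>" using b[OF that] by (intro mult_left_mono) auto
      finally show ?thesis .
    qed
    then show thesis using that[of "\<bar>B\<bar> * \<bar>b\<bar>"] by simp
  qed
  \<comment> \<open>Disjointness puts the centre \<open>v\<close> outside \<open>body u\<close>, so
    the centres are separated in terms of \<open>s0\<close> and \<open>separated_card_bound\<close>
    limits their number.\<close>
  define k where "k = nat \<lfloor>(\<kappa> * (2 * R / (s0 / 2) + 1)) ^ DIM('a)\<rfloor>"
  have "card F \<le> k" if F: "F \<subseteq> X" "finite F" "separated F" for F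
  proof -
    have "real (card F) \<le> (\<kappa> * (2 * R / (s0 / 2) + 1)) ^ DIM('a)"
    proof (rule separated_card_bound)
      fix u v assume uv: "u \<in> F" "v \<in> F" "u \<noteq> v"
      then have "disjnt (body u) (body v)" using F(3) by (simp add: pairwise_def)
      then have "v \<notin> body u" using center_in_body[of v] by (auto simp: disjnt_iff)
      then show "p (u - v) > s0 / 2 \<or> p (v - u) > s0 / 2" using s0 uv F(1) by fastforce
    qed (use F s0 R in auto)
    then show ?thesis by (simp add: k_def le_nat_floor)
  qed
  then obtain F where F: "F \<subseteq> X" "finite F" "separated F"
    "\<forall>x\<in>X. \<exists>y\<in>F. \<not> disjnt (body x) (body y) \<and> s y \<le> 2 * s x"
    using greedy_smallest_first[of X body k s0 s] s0 center_in_body by blast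
  define S where "S y = {x\<in>X. \<not> disjnt (body x) (body y) \<and> s y \<le> 2 * s x}" for y
  \<comment> \<open>The greedy choice makes \<open>body y\<close> at most twice as large as the
    bodies charged to it, which is the hypothesis \<open>large\<close> for \<rho> replaced by
    \<open>\<kappa> * s y\<close>.\<close>
  have "\<exists>G. finite G \<and> real (card G) \<le> cover_number \<and> S y \<subseteq> (\<Union>x\<in>G. body x)" for y
  proof -
    have "bounded (S y)" using assms by (rule bounded_subset) (auto simp: S_def)
    moreover have "\<kappa> * s y > 0" using \<kappa>1 s_pos[of y] by simp
    moreover have "p (y - x) \<le> s x + \<kappa> * s y" if "x \<in> S y" for x
      using that by (intro meeting_bodies) (simp add: S_def)
    moreover have "\<kappa> * s y \<le> 2 * \<kappa> * s x" if "x \<in> S y" for x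
      using that \<kappa>1 mult_left_mono[of "s y" "2 * s x" \<kappa>] by (simp add: S_def)
    ultimately show ?thesis
      by (elim cover_bodies_near_point[where a = y and s = s]) blast+
  qed
  then have "\<forall>y. \<exists>G. finite G \<and> real (card G) \<le> cover_number \<and> S y \<subseteq> (\<Union>x\<in>G. body x)" by blast
  from choice[OF this] obtain G where G: "\<And>y. finite (G y)" "\<And>y. real (card (G y)) \<le> cover_number"
    "\<And>y. S y \<subseteq> (\<Union>x\<in>G y. body x)" by blast
  show thesis
  proof
    show "F \<subseteq> X" "finite F" "separated F" using F by auto
    show "finite (\<Union>y\<in>F. G y)" using F G by blast
    have "real (card (\<Union>y\<in>F. G y)) \<le> (\<Sum>y\<in>F. real (card (G y)))"
      using card_UN_le[OF F(2), of G] by (metis of_nat_le_iff of_nat_sum)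
    also have "\<dots> \<le> (\<Sum>y\<in>F. cover_number)" using G by (intro sum_mono) auto
    finally show "real (card (\<Union>y\<in>F. G y)) \<le> cover_number * real (card F)" by (simp add: mult.commute)
    show "X \<subseteq> (\<Union>x\<in>(\<Union>y\<in>F. G y). body x)"
    proof
      fix x assume x: "x \<in> X"
      then obtain y where "y \<in> F" "x \<in> S y" using F(4) unfolding S_def by blast
      then show "x \<in> (\<Union>x\<in>(\<Union>y\<in>F. G y). body x)" using G(3)[of y] by blast
    qed
  qed
qed

lemma measure_bodies_le:
  assumes "finite G"
  shows "emeasure M (\<Union>x\<in>G. body x) \<le> ennreal (real (card G) * m)"
proof -
  have "emeasure M (\<Union>x\<in>G. body x) \<le> (\<Sum>x\<in>G. emeasure M (body x))"
    using assms body_sets by (intro emeasure_subadditive_finite) auto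
  also have "\<dots> = ennreal (real (card G) * m)"
    using m_pos by (simp add: mass ennreal_mult ennreal_of_nat_eq_real_of_nat)
  finally show ?thesis .
qed

text \<open>The ball \<open>cb 0 \<rho>\<close> stands for the bodies selected earlier. The
  essential point is that the loss \<open>Q\<close> is chosen before \<open>r\<close>. Centres lost
  through large bodies are covered by at most \<open>cover_number\<close> bodies; those lost through
  small bodies stay in a fixed compact set.\<close>

lemma separated_cover_avoiding:
  assumes "\<rho> > 0"
  obtains Q where "Q \<ge> 0"
    "\<And>r. \<exists>F. F \<subseteq> ball 0 r \<and> finite F \<and> separated F \<and> (\<forall>x\<in>F. disjnt (body x) (cb 0 \<rho>)) \<and>
      emeasure M (ball 0 r) \<le> ennreal (cover_number * real (card F) * m + Q)"
proof -
  \<comment> \<open>A body of radius below \<rho> that meets \<open>cb 0 \<rho>\<close> has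
    \<open>p (- x)\<close> at most \<open>\<rho> + \<kappa> * \<rho>\<close>; the outer \<kappa>
    turns this into a bound on \<open>p x\<close>.\<close>
  let ?Z = "cb 0 (\<kappa> * (\<rho> + \<kappa> * \<rho>))"
  define Q where "Q = cover_number * m + measure M ?Z"
  have "\<exists>F. F \<subseteq> ball 0 r \<and> finite F \<and> separated F \<and> (\<forall>x\<in>F. disjnt (body x) (cb 0 \<rho>)) \<and>
      emeasure M (ball 0 r) \<le> ennreal (cover_number * real (card F) * m + Q)" for r
  proof -
    define X where "X = {x\<in>ball 0 r. disjnt (body x) (cb 0 \<rho>)}"
    have "bounded X" by (rule bounded_subset[OF bounded_ball[of 0 r]]) (auto simp: X_def)
    then obtain F G where FG: "F \<subseteq> X" "finite F" "separated F"
      "finite G" "real (card G) \<le> cover_number * real (card F)" "X \<subseteq> (\<Union>x\<in>G. body x)"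
      by (rule separated_cover)
    define S where "S = {x\<in>ball 0 r. \<not> disjnt (body x) (cb 0 \<rho>) \<and> \<rho> \<le> s x}"
    have "bounded S" by (rule bounded_subset[OF bounded_ball[of 0 r]]) (auto simp: S_def)
    moreover have "\<kappa> * \<rho> > 0" using assms \<kappa>1 by simp
    moreover have "p (0 - x) \<le> s x + \<kappa> * \<rho>" if "x \<in> S" for x
      using that by (intro meeting_bodies) (simp add: S_def)
    moreover have "\<kappa> * \<rho> \<le> 2 * \<kappa> * s x" if "x \<in> S" for x
      using that \<kappa>1 s_pos[of x] mult_left_mono[of "\<rho>" "2 * s x" \<kappa>] by (simp add: S_def)
    ultimately obtain H where H: "finite H" "real (card H) \<le> cover_number" "S \<subseteq> (\<Union>x\<in>H. body x)"
      by (elim cover_bodies_near_point[where a = 0 and s = s]) blast+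
    have rest: "x \<in> ?Z" if "x \<in> ball 0 r" "x \<notin> X" "x \<notin> S" for x
    proof -
      have x: "\<not> disjnt (body x) (cb 0 \<rho>)" "s x < \<rho>" using that by (auto simp: X_def S_def)
      then have "p (- x) \<le> \<rho> + \<kappa> * \<rho>" using meeting_bodies[OF x(1)] by simp
      then have "\<kappa> * p (- x) \<le> \<kappa> * (\<rho> + \<kappa> * \<rho>)" using \<kappa>1 by (intro mult_left_mono) auto
      then have "p x \<le> \<kappa> * (\<rho> + \<kappa> * \<rho>)" using asym[of "- x"] by simp
      then show ?thesis by simp
    qed
    have Zs: "?Z \<in> sets M" using sets_M compact_cb borel_compact by blast
    have GHs: "(\<Union>x\<in>G \<union> H. body x) \<in> sets M" using FG H body_sets by (intro sets.finite_UN) auto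
    have "ball 0 r \<subseteq> (\<Union>x\<in>G \<union> H. body x) \<union> ?Z"
      using rest FG(6) H(3) by blast
    then have "emeasure M (ball 0 r) \<le> emeasure M ((\<Union>x\<in>G \<union> H. body x) \<union> ?Z)"
      using GHs Zs by (intro emeasure_mono) auto
    also have "\<dots> \<le> emeasure M (\<Union>x\<in>G \<union> H. body x) + emeasure M ?Z"
      using GHs Zs by (rule emeasure_subadditive)
    also have "\<dots> \<le> ennreal (real (card (G \<union> H)) * m) + ennreal (measure M ?Z)"
    proof (rule add_mono)
      show "emeasure M (\<Union>x\<in>G \<union> H. body x) \<le> ennreal (real (card (G \<union> H)) * m)"
        using FG H by (intro measure_bodies_le) auto
      show "emeasure M ?Z \<le> ennreal (measure M ?Z)"
        using fin[OF compact_cb[of 0 "\<kappa> * (\<rho> + \<kappa> * \<rho>)"]]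
        by (intro eq_refl emeasure_eq_ennreal_measure) auto
    qed
    also have "\<dots> = ennreal (real (card (G \<union> H)) * m + measure M ?Z)"
      using m_pos by (simp add: ennreal_plus)
    also have "\<dots> \<le> ennreal (cover_number * real (card F) * m + Q)"
    proof (rule ennreal_leI)
      have "real (card (G \<union> H)) \<le> cover_number * real (card F) + cover_number"
        using card_Un_le[of G H] FG(5) H(2) by linarith
      then have "real (card (G \<union> H)) * m \<le> (cover_number * real (card F) + cover_number) * m"
        using m_pos by (intro mult_right_mono) auto
      then show "real (card (G \<union> H)) * m + measure M ?Z \<le> cover_number * real (card F) * m + Q"
        by (simp add: Q_def algebra_simps)
    qed
    finally show ?thesis using FG(1-3) unfolding X_def by (intro exI[of _ F]) auto
  qed
  moreover have "Q \<ge> 0" using cover_number_ge1 m_pos by (simp add: Q_def)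
  ultimately show thesis using that by blast
qed

end

section \<open>The gauge of a convex body\<close>

text \<open>\<open>p\<close> is the Minkowski functional of \<open>C - c\<close> for the centre
  \<open>c\<close> of bounded asymmetry; the defining property of \<open>c\<close> is exactly the
  inequality \<open>asym\<close> with constant the dimension.\<close>

lemma exists_gauge:
  fixes C :: "'a::euclidean_space set"
  assumes "convex_body C"
  obtains p c where "asym_norm p (real DIM('a))"
    "\<And>x r. r > 0 \<Longrightarrow> {y. p (y - x) \<le> r} = (\<lambda>y. r *\<^sub>R y + (x - r *\<^sub>R c)) ` C"
proof -
  let ?n = "real DIM('a)"
  have n: "?n \<ge> 1" by (simp add: DIM_ge_Suc0 Suc_leI)
  have C: "convex C" "compact C" "interior C \<noteq> {}" using assms by (auto simp: convex_body_def)
  then have "C \<noteq> {}" by auto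
  then obtain c where c: "c \<in> C" "\<And>x. x \<in> C \<Longrightarrow> c - (1 / ?n) *\<^sub>R (x - c) \<in> C"
    using exists_center_bounded_asymmetry[OF C(1,2)] by blast
  have "c \<in> interior C"
  proof -
    obtain z where z: "z \<in> interior C" using C by blast
    \<comment> \<open>The centre lies strictly between an interior point \<open>z\<close> and the
      point \<open>w\<close> of \<open>C\<close> opposite to it, so it is interior too.\<close>
    define w where "w = c - (1 / ?n) *\<^sub>R (z - c)"
    have "w \<in> C" using c(2)[of z] z interior_subset w_def by blast
    then have "w - (1 / (?n + 1)) *\<^sub>R (w - z) \<in> interior C"
      using n z C by (intro mem_interior_convex_shrink) auto
    moreover have "w - (1 / (?n + 1)) *\<^sub>R (w - z) = c"
    proof -
      have "w - z = - ((1 + 1 / ?n) *\<^sub>R (z - c))" by (simp add: w_def algebra_simps)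
      then have "w - (1 / (?n + 1)) *\<^sub>R (w - z) = w + ((1 / (?n + 1)) * (1 + 1 / ?n)) *\<^sub>R (z - c)"
        by simp
      also have "(1 / (?n + 1)) * (1 + 1 / ?n) = 1 / ?n" using n by (simp add: field_simps)
      finally show ?thesis by (simp add: w_def)
    qed
    ultimately show ?thesis by simp
  qed
  then obtain e where e: "e > 0" "cball c e \<subseteq> C" unfolding mem_interior_cball by blast
  obtain R where R: "R > 0" "\<And>y. y \<in> C \<Longrightarrow> norm (y - c) \<le> R"
  proof -
    obtain B where "\<forall>y\<in>C. dist c y \<le> B"
      using compact_imp_bounded[OF C(2)] bounded_any_center[of C c] by blast
    then have "norm (y - c) \<le> max B 1" if "y \<in> C" for y
      using that by (force simp: dist_norm norm_minus_commute)
    then show thesis using that[of "max B 1"] by simp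
  qed
  define A where "A x = {t. 0 < t \<and> c + (1 / t) *\<^sub>R x \<in> C}" for x
  have up: "u \<in> A x" if "t \<in> A x" "t \<le> u" for t u x
  proof -
    have t: "0 < t" "c + (1 / t) *\<^sub>R x \<in> C" using that by (auto simp: A_def)
    then have "(1 - t / u) *\<^sub>R c + (t / u) *\<^sub>R (c + (1 / t) *\<^sub>R x) \<in> C"
      using that c(1) by (intro convexD[OF C(1)]) auto
    also have "(1 - t / u) *\<^sub>R c + (t / u) *\<^sub>R (c + (1 / t) *\<^sub>R x) = c + (1 / u) *\<^sub>R x"
      using t by (simp add: algebra_simps)
    finally show ?thesis using t that by (simp add: A_def)
  qed
  have large: "t \<in> A x" if "t > 0" "norm x \<le> t * e" for t x
  proof -
    have "norm x / t \<le> e" using that by (simp add: pos_divide_le_eq mult.commute)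
    then have "c + (1 / t) *\<^sub>R x \<in> cball c e" using that by (simp add: dist_norm)
    then show ?thesis using e that by (auto simp: A_def)
  qed
  have small: "norm x \<le> R * t" if "t \<in> A x" for t x
  proof -
    have "norm x / t \<le> R" using R(2)[of "c + (1 / t) *\<^sub>R x"] that by (simp add: A_def)
    then show ?thesis using that by (simp add: A_def pos_divide_le_eq)
  qed
  have ne: "A x \<noteq> {}" for x
  proof -
    have "norm x / e + 1 \<in> A x"
      using e by (intro large) (auto simp: add_nonneg_pos distrib_right)
    then show ?thesis by blast
  qed
  have bdd: "bdd_below (A x)" for x by (rule bdd_belowI[of _ 0]) (auto simp: A_def)
  define p where "p x = Inf (A x)" for x
  have p_nonneg: "p x \<ge> 0" for x
    unfolding p_def using ne by (intro cInf_greatest) (auto simp: A_def)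
  have p_less: "r \<in> A x" if "p x < r" for r x
    using that up cInf_less_iff[OF ne bdd] unfolding p_def by (meson less_imp_le)
  \<comment> \<open>Closedness of \<open>C\<close> makes the infimum attained at positive values. As
    \<open>p\<close> may vanish, the equivalence is only available for \<open>r > 0\<close>, and the
    laws of the gauge are proved below up to an arbitrary positive error.\<close>
  have key: "p x \<le> r \<longleftrightarrow> r \<in> A x" if r: "r > 0" for r x
  proof
    assume le: "p x \<le> r"
    have lim: "(\<lambda>k. c + (1 / (r + 1 / real (Suc k))) *\<^sub>R x) \<longlonglongrightarrow> c + (1 / (r + 0)) *\<^sub>R x"
      using r by (intro tendsto_intros LIMSEQ_Suc lim_1_over_n) auto
    have mem: "c + (1 / (r + 1 / real (Suc k))) *\<^sub>R x \<in> C" for k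
    proof -
      have "0 < 1 / real (Suc k)" by simp
      then have "p x < r + 1 / real (Suc k)" using le by linarith
      then show ?thesis using p_less unfolding A_def by blast
    qed
    have "c + (1 / (r + 0)) *\<^sub>R x \<in> C"
      by (rule closed_sequentially[OF compact_imp_closed[OF C(2)] mem lim])
    then show "r \<in> A x" using r by (simp add: A_def)
  next
    assume "r \<in> A x"
    then show "p x \<le> r" unfolding p_def by (rule cInf_lower[OF _ bdd])
  qed
  have "asym_norm p ?n"
  proof
    show "p (t *\<^sub>R x) = t * p x" if t: "0 \<le> t" for t x
    proof (cases "t = 0")
      case True
      have "p 0 \<le> r" if "r > 0" for r using that large[of r 0] key e by simp
      then have "p 0 \<le> 0" by (meson dense not_le)
      then show ?thesis using True p_nonneg[of 0] by simp
    next
      case False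
      then have t: "t > 0" using t by simp
      have iff: "p (t *\<^sub>R x) \<le> r \<longleftrightarrow> t * p x \<le> r" if "r > 0" for r
      proof -
        have "p (t *\<^sub>R x) \<le> r \<longleftrightarrow> r / t \<in> A x" using key that t by (simp add: A_def)
        also have "\<dots> \<longleftrightarrow> p x \<le> r / t" using key[of "r / t" x] that t by simp
        also have "\<dots> \<longleftrightarrow> t * p x \<le> r" using t by (simp add: pos_le_divide_eq mult.commute)
        finally show ?thesis .
      qed
      show ?thesis
      proof (rule antisym; rule field_le_epsilon)
        fix d :: real assume "d > 0"
        have "t * p x + d > 0" "p (t *\<^sub>R x) + d > 0" using \<open>d > 0\<close> t p_nonneg by (auto intro: add_nonneg_pos)
        then show "p (t *\<^sub>R x) \<le> t * p x + d" "t * p x \<le> p (t *\<^sub>R x) + d"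
          using iff[of "t * p x + d"] iff[of "p (t *\<^sub>R x) + d"] \<open>d > 0\<close> by simp_all
      qed
    qed
    show "p (x + y) \<le> p x + p y" for x y
    proof (rule field_le_epsilon)
      fix d :: real assume d: "d > 0"
      define r u where "r = p x + d / 2" and "u = p y + d / 2"
      have ru: "r > 0" "u > 0" using d p_nonneg[of x] p_nonneg[of y] by (auto simp: r_def u_def)
      have "r \<in> A x" "u \<in> A y" using d by (auto intro!: p_less simp: r_def u_def)
      then have "(r / (r + u)) *\<^sub>R (c + (1 / r) *\<^sub>R x) + (u / (r + u)) *\<^sub>R (c + (1 / u) *\<^sub>R y) \<in> C"
        using ru by (intro convexD[OF C(1)]) (auto simp: A_def add_divide_distrib[symmetric])
      also have "(r / (r + u)) *\<^sub>R (c + (1 / r) *\<^sub>R x) + (u / (r + u)) *\<^sub>R (c + (1 / u) *\<^sub>R y)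
        = ((r + u) / (r + u)) *\<^sub>R c + (1 / (r + u)) *\<^sub>R (x + y)"
        using ru by (simp add: scaleR_add_right scaleR_add_left add_divide_distrib del: divide_self_if)
      also have "\<dots> = c + (1 / (r + u)) *\<^sub>R (x + y)" using ru by simp
      finally have "p (x + y) \<le> r + u" using key[of "r + u" "x + y"] ru by (simp add: A_def)
      then show "p (x + y) \<le> p x + p y + d" by (simp add: r_def u_def)
    qed
    show "p (- x) \<le> ?n * p x" for x
    proof (rule field_le_epsilon)
      fix d :: real assume d: "d > 0"
      define r where "r = p x + d / ?n"
      have r: "r > 0" using d n p_nonneg[of x] by (auto simp: r_def intro: add_nonneg_pos)
      have "r \<in> A x" using d n by (auto intro!: p_less simp: r_def)
      then have "c - (1 / ?n) *\<^sub>R (c + (1 / r) *\<^sub>R x - c) \<in> C" using c(2) unfolding A_def by blast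
      then have "?n * r \<in> A (- x)" using r n by (simp add: A_def)
      then have "p (- x) \<le> ?n * r" using key[of "?n * r" "- x"] r n by simp
      then show "p (- x) \<le> ?n * p x + d" using n by (simp add: r_def algebra_simps)
    qed
    show "?n \<ge> 1" by fact
    have "norm x \<le> R * p x" for x
    proof (rule field_le_epsilon)
      fix d :: real assume d: "d > 0"
      have "p x + d / R \<in> A x" using d R by (intro p_less) auto
      then show "norm x \<le> R * p x + d" using small[of "p x + d / R" x] R by (simp add: algebra_simps)
    qed
    then have "(1 / R) * norm x \<le> p x" for x using R by (simp add: pos_divide_le_eq mult.commute)
    then show "\<exists>b>0. \<forall>x. b * norm x \<le> p x" using R by (intro exI[of _ "1 / R"]) auto
    have "p x \<le> (1 / e) * norm x" for x
    proof (rule field_le_epsilon)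
      fix d :: real assume d: "d > 0"
      have "norm x / e + d > 0" using d e by (intro add_nonneg_pos) auto
      moreover have "norm x \<le> (norm x / e + d) * e" using d e by (simp add: algebra_simps)
      ultimately show "p x \<le> (1 / e) * norm x + d" using large key[of "norm x / e + d" x] by simp
    qed
    then show "\<exists>B. \<forall>x. p x \<le> B * norm x" by blast
  qed
  moreover have "{y. p (y - x) \<le> r} = (\<lambda>y. r *\<^sub>R y + (x - r *\<^sub>R c)) ` C" if r: "r > 0" for x r
  proof (intro equalityI subsetI)
    fix y assume "y \<in> {y. p (y - x) \<le> r}"
    then have "c + (1 / r) *\<^sub>R (y - x) \<in> C" using key[OF r, of "y - x"] by (simp add: A_def)
    moreover have "y = r *\<^sub>R (c + (1 / r) *\<^sub>R (y - x)) + (x - r *\<^sub>R c)"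
      using r by (simp add: algebra_simps)
    ultimately show "y \<in> (\<lambda>y. r *\<^sub>R y + (x - r *\<^sub>R c)) ` C" by blast
  next
    fix y assume "y \<in> (\<lambda>y. r *\<^sub>R y + (x - r *\<^sub>R c)) ` C"
    then obtain z where z: "z \<in> C" "y = r *\<^sub>R z + (x - r *\<^sub>R c)" by blast
    then have "y - x = r *\<^sub>R (z - c)" by (simp add: algebra_simps)
    then have "c + (1 / r) *\<^sub>R (y - x) = z" using r by simp
    then have "r \<in> A (y - x)" using z r by (simp add: A_def)
    then show "y \<in> {y. p (y - x) \<le> r}" using key[OF r] by simp
  qed
  ultimately show thesis using that by blast
qed

section \<open>Packings of positive upper density\<close>

context equal_mass_bodies
begin

text \<open>Disjoint bodies with different centres are different sets, so no mass is lost in passing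
  from centres to bodies; a body whose centre is in the ball meets the ball.\<close>

lemma d_out_ge:
  assumes "separated F" "G \<subseteq> F" "finite G" "G \<subseteq> ball 0 r"
  shows "ennreal (real (card G) * m) / emeasure M (ball 0 r) \<le> d_out M (body ` F) (ball 0 r)"
proof -
  have inj: "inj_on body G"
  proof (rule inj_onI, rule ccontr)
    fix x y assume xy: "x \<in> G" "y \<in> G" "body x = body y" "x \<noteq> y"
    then have "disjnt (body x) (body y)" using assms by (meson pairwiseD subsetD)
    then show False using xy(3) center_in_body[of x] unfolding disjnt_iff by blast
  qed
  have "ennreal (real (card G) * m) = (\<Sum>A\<in>body ` G. emeasure M A)"
    unfolding sum.reindex[OF inj] using m_pos
    by (simp add: mass ennreal_mult ennreal_of_nat_eq_real_of_nat)
  also have "\<dots> \<le> (SUP H\<in>{H. finite H \<and> H \<subseteq> {A\<in>body ` F. A \<inter> ball 0 r \<noteq> {}}}. \<Sum>A\<in>H. emeasure M A)"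
  proof (rule SUP_upper)
    have "body x \<inter> ball 0 r \<noteq> {}" if "x \<in> G" for x
      using center_in_body[of x] that assms(4) by blast
    then show "body ` G \<in> {H. finite H \<and> H \<subseteq> {A\<in>body ` F. A \<inter> ball 0 r \<noteq> {}}}"
      using assms by blast
  qed
  finally show ?thesis unfolding d_out_def by (rule divide_right_mono_ennreal)
qed

lemma exists_dense_separated:
  "\<exists>F. separated F \<and> ennreal (1 / (2 * cover_number)) \<le> d_upp M (body ` F)"
proof -
  let ?b = "\<lambda>r. emeasure M (ball 0 r)"
  let ?g = "ennreal (1 / (2 * cover_number))"
  have cn: "cover_number > 0" using cover_number_ge1 by simp
  have b_fin: "?b r < \<infinity>" for r
  proof -
    have "?b r \<le> emeasure M (cball 0 r)" using ball_subset_cball by (intro emeasure_mono) (auto simp: sets_M)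
    then show ?thesis using fin[OF compact_cball] by (rule le_less_trans)
  qed
  have b_real: "?b r = ennreal (measure M (ball 0 r))" for r
    using b_fin[of r] by (intro emeasure_eq_ennreal_measure) auto
  have b_mono: "?b r \<le> ?b t" if "r \<le> t" for r t
    using that subset_ball by (intro emeasure_mono) (auto simp: sets_M)
  have b_sup: "(SUP k::nat. ?b (real k)) = emeasure M UNIV"
  proof -
    have "(\<Union>k::nat. ball (0::'a) (real k)) = UNIV" using reals_Archimedean2 by auto
    moreover have "(SUP k::nat. ?b (real k)) = emeasure M (\<Union>k::nat. ball 0 (real k))"
      by (rule SUP_emeasure_incseq) (auto simp: sets_M incseq_def)
    ultimately show ?thesis by simp
  qed
  have dens: "?g \<le> ennreal (real k * m) / ennreal B"
    if "B > 0" "B \<le> 2 * cover_number * real k * m" for k B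
  proof -
    have "1 / (2 * cover_number) \<le> real k * m / B"
      using that cn by (simp add: field_simps)
    then have "?g \<le> ennreal (real k * m / B)" by (rule ennreal_leI)
    then show ?thesis using that m_pos by (simp add: divide_ennreal)
  qed
  show ?thesis
  proof (cases "emeasure M UNIV = \<infinity>")
    case False
    define T where "T = measure M UNIV"
    have T: "emeasure M UNIV = ennreal T" unfolding T_def using False by (intro emeasure_eq_ennreal_measure) auto
    have "emeasure M (body 0) \<le> emeasure M UNIV" using body_sets sets_M by (intro emeasure_mono) auto
    then have T_pos: "T > 0" using mass[of 0] T m_pos by (metis ennreal_le_iff2 not_less order_trans)
    \<comment> \<open>A ball with more than half of the total mass is enough: enlarging it at most
      doubles its mass, which accounts for the 2 in the density.\<close>
    then have "ennreal (T / 2) < (SUP k::nat. ?b (real k))"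
      unfolding b_sup T by (simp add: ennreal_lessI)
    then obtain k :: nat where k: "ennreal (T / 2) < ?b (real k)" unfolding less_SUP_iff by blast
    obtain F G where FG: "F \<subseteq> ball 0 (real k)" "finite F" "separated F"
      "finite G" "real (card G) \<le> cover_number * real (card F)" "ball 0 (real k) \<subseteq> (\<Union>x\<in>G. body x)"
      by (rule separated_cover[OF bounded_ball])
    have "?b (real k) \<le> emeasure M (\<Union>x\<in>G. body x)"
      using FG body_sets by (intro emeasure_mono) auto
    also have "\<dots> \<le> ennreal (real (card G) * m)" using FG by (intro measure_bodies_le)
    finally have "ennreal (T / 2) < ennreal (real (card G) * m)" using k by simp
    then have "T / 2 < real (card G) * m" using m_pos by (simp add: ennreal_less_iff T_pos less_imp_le)
    also have "\<dots> \<le> cover_number * real (card F) * m" using FG m_pos by (intro mult_right_mono) auto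
    finally have TF: "T \<le> 2 * cover_number * real (card F) * m" by simp
    have "?g \<le> d_out M (body ` F) (ball 0 r)" if r: "r \<ge> real k" for r
    proof -
      have "ennreal (T / 2) < ennreal (measure M (ball 0 r))"
        using k b_mono[OF r] unfolding b_real[symmetric] by (rule less_le_trans)
      then have "measure M (ball 0 r) > 0" using T_pos by (simp add: ennreal_less_iff less_imp_le)
      moreover have "?b r \<le> ennreal T" unfolding T[symmetric] by (intro emeasure_mono) (auto simp: sets_M)
      then have "measure M (ball 0 r) \<le> T" unfolding b_real using T_pos by (simp add: ennreal_le_iff)
      then have "measure M (ball 0 r) \<le> 2 * cover_number * real (card F) * m" using TF by linarith
      ultimately have "?g \<le> ennreal (real (card F) * m) / ?b r" unfolding b_real by (rule dens)
      also have "\<dots> \<le> d_out M (body ` F) (ball 0 r)"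
        using FG r subset_ball[OF r] by (intro d_out_ge) auto
      finally show ?thesis .
    qed
    then have "\<forall>\<^sub>F r in at_top. ?g \<le> d_out M (body ` F) (ball 0 r)"
      unfolding eventually_at_top_linorder by blast
    then have "?g \<le> d_upp M (body ` F)" unfolding d_upp_def by (intro le_Limsup) auto
    then show ?thesis using FG by blast
  next
    case True
    define P where "P k F \<longleftrightarrow> finite F \<and> separated F" for k :: nat and F :: "'a set"
    \<comment> \<open>Stage \<open>k\<close> must provide a radius at least \<open>k\<close> at
      which the enlarged family already has the wanted density. Later stages only add bodies, so
      this survives in the union.\<close>
    define Q where "Q k F F' \<longleftrightarrow> F \<subseteq> F' \<and> (\<exists>r\<ge>real k. \<exists>G\<subseteq>F'. finite G \<and> G \<subseteq> ball 0 r \<and>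
      0 < measure M (ball 0 r) \<and> measure M (ball 0 r) \<le> 2 * cover_number * real (card G) * m)"
      for k :: nat and F F' :: "'a set"
    have "\<exists>f. \<forall>k. P k (f k) \<and> Q k (f k) (f (Suc k))"
    proof (rule dependent_nat_choice)
      show "\<exists>F. P 0 F" by (intro exI[of _ "{}"]) (simp add: P_def)
      fix F k assume "P k F"
      then have F: "finite F" "separated F" by (auto simp: P_def)
      have "compact (\<Union>x\<in>F. body x)" using F compact_cb by (intro compact_UN) auto
      then have "compact (p ` (\<Union>x\<in>F. body x))"
        using continuous by (intro compact_continuous_image) (auto intro: continuous_on_subset)
      then have "bdd_above (p ` (\<Union>x\<in>F. body x))" by (intro bounded_imp_bdd_above compact_imp_bounded)
      then obtain \<rho>0 where "\<forall>z\<in>p ` (\<Union>x\<in>F. body x). z \<le> \<rho>0" unfolding bdd_above_def by blast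
      then have \<rho>0: "p y \<le> \<rho>0" if "x \<in> F" "y \<in> body x" for x y using that by blast
      define \<rho> where "\<rho> = max \<rho>0 1"
      have \<rho>: "\<rho> > 0" by (simp add: \<rho>_def)
      have sub: "body x \<subseteq> cb 0 \<rho>" if "x \<in> F" for x
        using \<rho>0[OF that] by (auto simp: \<rho>_def le_max_iff_disj)
      obtain q where q: "q \<ge> 0" "\<And>r. \<exists>H. H \<subseteq> ball 0 r \<and> finite H \<and> separated H \<and>
        (\<forall>x\<in>H. disjnt (body x) (cb 0 \<rho>)) \<and> ?b r \<le> ennreal (cover_number * real (card H) * m + q)"
        using separated_cover_avoiding[OF \<rho>] by blast
      \<comment> \<open>Once the ball has mass above \<open>2 * q + 1\<close>, the loss
        \<open>q\<close> is less than half of it and is absorbed by doubling the constant.\<close>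
      have "ennreal (2 * q + 1) < (SUP k::nat. ?b (real k))" unfolding b_sup True by simp
      then obtain j :: nat where "ennreal (2 * q + 1) < ?b (real j)" unfolding less_SUP_iff by blast
      moreover define r where "r = real (max j k)"
      ultimately have "ennreal (2 * q + 1) < ennreal (measure M (ball 0 r))"
        using b_mono[of "real j" r] unfolding b_real[symmetric] by (simp add: less_le_trans)
      then have big: "2 * q + 1 < measure M (ball 0 r)"
        by (rule ennreal_less_iff[THEN iffD1, rotated]) (use q in simp)
      obtain H where H: "H \<subseteq> ball 0 r" "finite H" "separated H" "\<And>x. x \<in> H \<Longrightarrow> disjnt (body x) (cb 0 \<rho>)"
        "?b r \<le> ennreal (cover_number * real (card H) * m + q)" using q(2)[of r] by blast
      have "0 \<le> cover_number * real (card H) * m + q" using cn m_pos q by simp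
      then have "measure M (ball 0 r) \<le> cover_number * real (card H) * m + q"
        using H(5) unfolding b_real by (rule ennreal_le_iff[THEN iffD1])
      then have le: "measure M (ball 0 r) \<le> 2 * cover_number * real (card H) * m" using big by linarith
      have "disjnt (body x) (body y)" if "x \<in> F" "y \<in> H" for x y
        using sub[OF that(1)] H(4)[OF that(2)] by (meson disjnt_subset1 disjnt_sym)
      then have "separated (F \<union> H)"
        using F(2) H(3) unfolding pairwise_def by (metis UnE disjnt_sym)
      then have "P (Suc k) (F \<union> H)" using F H by (simp add: P_def)
      moreover have "Q k F (F \<union> H)"
        unfolding Q_def using H big q le
        by (intro conjI exI[of _ r] exI[of _ H]) (auto simp: r_def)
      ultimately show "\<exists>F'. P (Suc k) F' \<and> Q k F F'" by blast
    qed
    then obtain f where f: "\<And>k. P k (f k)" "\<And>k. Q k (f k) (f (Suc k))" by blast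
    have "mono f" using f(2) by (intro incseq_SucI) (simp add: Q_def)
    define F where "F = (\<Union>k. f k)"
    have sep: "separated F"
    proof (rule pairwiseI)
      fix x y assume xy: "x \<in> F" "y \<in> F" "x \<noteq> y"
      then obtain i j where "x \<in> f i" "y \<in> f j" unfolding F_def by blast
      then have "x \<in> f (max i j)" "y \<in> f (max i j)"
        using monoD[OF \<open>mono f\<close>, of i "max i j"] monoD[OF \<open>mono f\<close>, of j "max i j"] by auto
      then show "disjnt (body x) (body y)"
        using f(1)[of "max i j"] xy(3) unfolding P_def by (meson pairwiseD)
    qed
    \<comment> \<open>Density at arbitrarily large radii suffices, because the upper density is a
      limes superior.\<close>
    have often: "\<exists>r\<ge>real k. ?g \<le> d_out M (body ` F) (ball 0 r)" for k
    proof -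
      obtain r G where rG: "r \<ge> real k" "G \<subseteq> f (Suc k)" "finite G" "G \<subseteq> ball 0 r"
        "0 < measure M (ball 0 r)" "measure M (ball 0 r) \<le> 2 * cover_number * real (card G) * m"
        using f(2)[of k] unfolding Q_def by blast
      have "?g \<le> ennreal (real (card G) * m) / ?b r" unfolding b_real using rG by (intro dens)
      also have "\<dots> \<le> d_out M (body ` F) (ball 0 r)"
        using rG sep by (intro d_out_ge) (auto simp: F_def)
      finally show ?thesis using rG(1) by blast
    qed
    have "?g \<le> d_upp M (body ` F)"
      unfolding d_upp_def
    proof (rule Limsup_greatest)
      fix E :: "real \<Rightarrow> bool" assume "eventually E at_top"
      then obtain N where N: "\<And>r. r \<ge> N \<Longrightarrow> E r" unfolding eventually_at_top_linorder by blast
      obtain k :: nat where "N \<le> real k" using real_arch_simple by blast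
      then obtain r where r: "E r" "?g \<le> d_out M (body ` F) (ball 0 r)"
        using often[of k] N by (meson order_trans)
      then show "?g \<le> (SUP r\<in>Collect E. d_out M (body ` F) (ball 0 r))"
        by (intro SUP_upper2[of r]) auto
    qed
    then show ?thesis using sep by blast
  qed
qed

end

theorem mainTheorem5:
  shows "\<exists>g::real. g > 0 \<and>
    (\<forall>(C::'a::euclidean_space set) (M::'a measure).
       convex_body C \<and> loc_finite_borel M \<and> non_C_degenerate M C \<and>
       emeasure M C > 0 \<and> emeasure M C < emeasure M UNIV
       \<longrightarrow> delta_H M C \<ge> ennreal g)"
proof -
  let ?n = "real DIM('a)"
  \<comment> \<open>This is \<open>1 / (2 * cover_number)\<close> with \<kappa> equal to the
    dimension, written out because it must be fixed before \<open>C\<close> and its gauge are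
    given.\<close>
  define g where "g = 1 / (2 * (2 * (?n * (64 * ?n + 1)) ^ DIM('a)))"
  have n: "?n \<ge> 1" by (simp add: DIM_ge_Suc0 Suc_leI)
  have "(?n * (64 * ?n + 1)) ^ DIM('a) > 0" using n by (intro zero_less_power mult_pos_pos) auto
  then have "g > 0" by (simp add: g_def)
  moreover have "ennreal g \<le> delta_H M C"
    if h: "convex_body C" "loc_finite_borel M" "non_C_degenerate M C"
      "emeasure M C > 0" "emeasure M C < emeasure M UNIV" for C :: "'a set" and M
  proof -
    obtain p c where p: "asym_norm p ?n"
      and ball: "\<And>x r. r > 0 \<Longrightarrow> {y. p (y - x) \<le> r} = (\<lambda>y. r *\<^sub>R y + (x - r *\<^sub>R c)) ` C"
      using exists_gauge[OF h(1)] by blast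
    interpret asym_norm p ?n by (rule p)
    have hom: "cb x r \<in> homothets C" if "r > 0" for x r
      unfolding homothets_def ball[OF that] using that by blast
    have sets: "sets M = sets borel" and fin: "\<And>K. compact K \<Longrightarrow> emeasure M K < \<infinity>"
      using h(2) by (auto simp: loc_finite_borel_def)
    have frontier: "emeasure M (frontier (cb x r)) = 0" if "r > 0" for x r
      using \<open>non_C_degenerate M C\<close> hom[OF that] by (simp add: non_C_degenerate_def)
    have point: "emeasure M {x} = 0" for x
    proof -
      \<comment> \<open>Any point lies on the boundary of some homothet: here on the sphere of
        radius \<open>p v\<close> about \<open>x - v\<close>.\<close>
      obtain v :: 'a where "v \<in> Basis" using nonempty_Basis by blast
      then have v: "p v > 0" using pos nonzero_Basis by blast
      have "{x} \<subseteq> frontier (cb (x - v) (p v))" using sphere_subset_frontier[OF v, of "x - v"] by auto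
      then have "emeasure M {x} \<le> emeasure M (frontier (cb (x - v) (p v)))"
        by (intro emeasure_mono) (auto simp: sets frontier_closed)
      then show ?thesis using frontier[OF v] by simp
    qed
    have "\<forall>x. \<exists>r. r > 0 \<and> emeasure M (cb x r) = emeasure M C"
      using exists_radius[OF sets fin frontier point h(4,5)] by blast
    from choice[OF this] obtain s where s: "\<And>x. s x > 0" "\<And>x. emeasure M (cb x (s x)) = emeasure M C" by blast
    have mC: "emeasure M C = ennreal (measure M C)"
      using h(5) by (intro emeasure_eq_ennreal_measure) auto
    interpret equal_mass_bodies p ?n M "measure M C" s
    proof
      show "measure M C > 0" using h(4) mC by (metis ennreal_less_zero_iff)
      show "emeasure M (cb x (s x)) = ennreal (measure M C)" for x using s(2) mC by simp
    qed (use sets fin point s in auto)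
    obtain F where F: "separated F" "ennreal (1 / (2 * cover_number)) \<le> d_upp M (body ` F)"
      using exists_dense_separated by blast
    have "packing (body ` F)"
      unfolding packing_def
    proof (intro ballI impI)
      fix A B assume AB: "A \<in> body ` F" "B \<in> body ` F" "A \<noteq> B"
      then obtain x y where xy: "x \<in> F" "y \<in> F" "A = body x" "B = body y" by blast
      then have "x \<noteq> y" using AB(3) by blast
      then have "disjnt A B" using pairwiseD[OF F(1) xy(1,2)] xy by simp
      then show "interior A \<inter> interior B = {}"
        using interior_subset[of A] interior_subset[of B] by (auto simp: disjnt_iff)
    qed
    moreover have "body ` F \<subseteq> homothets C" using hom s(1) by blast
    moreover have "\<forall>A\<in>body ` F. emeasure M A = emeasure M C" using s(2) by blast
    ultimately have "d_upp M (body ` F) \<le> delta_H M C"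
      unfolding delta_H_def by (intro SUP_upper) blast
    moreover have "1 / (2 * cover_number) = g" by (simp add: g_def cover_number_def)
    ultimately show ?thesis using F(2) by simp
  qed
  ultimately show ?thesis by blast
qed

end
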